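(* Suppose the DAE $\dot y=f(y,z,t)$, $0=g(y,z,t)$ is either semi-explicit index-1 or Hessenberg index-2, with true solution $[y,z]^T$, and let $[Y,Z]^T$ be its numerical solution. Let $\dot y=f(y,z,t)$, $\dot z=h(y,z,t)$ be the corresponding index-reduced ODE, and let $(\nu^{(y)},\nu^{(z)})$ solve the adjoint ODE problem $$-\dot{\nu}^{(y)}=\bar f_y^T\nu^{(y)}+\bar h_y^T\nu^{(z)}+\psi^y,\qquad -\dot{\nu}^{(z)}=\bar f_z^T\nu^{(y)}+\bar h_z^T\nu^{(z)}+\psi^z,\qquad t\in[0,T),$$ with $\nu^{(y)}(T)=0$ and $\nu^{(z)}(T)=0$. Then the error $e^{\mathcal{Q}_{[0,T]}}=\langle e^{(y)},\psi^y\rangle+\langle e^{(z)},\psi^z\rangle$ in the computed quantity of interest $\mathcal{Q}_{[0,T]}(Y,Z)$ is $$e^{\mathcal{Q}_{[0,T]}}=\big(\nu^{(y)}(0),e^{(y)}(0)\big)+\big(\nu^{(z)}(0),e^{(z)}(0)\big)+\langle\nu^{(y)},f(Y,Z)-\dot Y\rangle+\langle\nu^{(z)},h(Y,Z)-\dot Z\rangle.$$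
   Context: Setting: $y(t)\in\mathbb{R}^n$, $z(t)\in\mathbb{R}^m$, $t\in[0,T]$; $f$ takes values in $\mathbb{R}^n$, $g$ in $\mathbb{R}^m$, both smooth enough that all derivatives that appear exist and are continuous; subscripts denote partial derivatives (Jacobians). The DAE is index-1 if $g_z$ is invertible in a neighborhood of the solution, and Hessenberg index-2 if $g=g(y,t)$ does not depend on $z$ and $g_yf_z\in\mathbb{R}^{m\times m}$ is invertible in a neighborhood of the solution. Explicit dependence on $t$ is suppressed: $f(Y,Z)$ means $f(Y(t),Z(t),t)$, etc. The function $h$ is obtained by differentiating the constraint and solving for $\dot z$: $$h=\begin{cases}-[g_z]^{-1}[g_yf+g_t], & \text{if the DAE is index-1},\\ -(g_yf_z)^{-1}\left(f^Tg_{yy}f+g_yf_yf+2g_{yt}f+g_yf_t+g_{tt}\right), & \text{if the DAE is index-2},\end{cases}$$ where $(f^Tg_{yy}f)_i=\sum_{j,k=1}^n\frac{\partial^2g_i}{\partial y_j\partial y_k}f_jf_k$, $i=1,\dots,m$. The true solution $[y,z]^T$ of the DAE also solves $\dot y=f$, $\dot z=h$. Numerical solution: with $t_k=k\Delta t$, $\Delta t=T/N$, $Y_0=y(0)$, $Z_0=z(0)$, the values satisfy the BDF-1 (implicit Euler) equations for the DAE, $Y_{k+1}=Y_k+\Delta t\,f(Y_{k+1},Z_{k+1},t_{k+1})$, $0=g(Y_{k+1},Z_{k+1},t_{k+1})$ (with $g(Y_{k+1},t_{k+1})$ in the index-2 case), $k=0,\dots,N-1$. $Y(t),Z(t)$ are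 the continuous piecewise linear interpolants of these values. Their time derivatives are taken piecewise. $e^{(y)}=y-Y$, $e^{(z)}=z-Z$. The numerical solution is assumed close enough to the true one that $h$ and its Jacobians are defined and continuous along the segments joining $(Y(t),Z(t))$ and $(y(t),z(t))$. $(\cdot,\cdot)$ is the Euclidean inner product and $\langle a,b\rangle=\int_0^T(a(t),b(t))\,dt$. For given $\psi^y\in[L^2(0,T)]^n$, $\psi^z\in[L^2(0,T)]^m$, $\mathcal{Q}_{[0,T]}(y,z)=\langle y,\psi^y\rangle+\langle z,\psi^z\rangle$ and $e^{\mathcal{Q}_{[0,T]}}=\mathcal{Q}_{[0,T]}(y,z)-\mathcal{Q}_{[0,T]}(Y,Z)$. Linearized operators (functions of $t$): $\bar f_y=\int_0^1\frac{\partial f}{\partial y}(\tilde y,\tilde z,t)ds$, $\bar f_z=\int_0^1\frac{\partial f}{\partial z}(\tilde y,\tilde z,t)ds$, $\bar h_y=\int_0^1\frac{\partial h}{\partial y}(\tilde y,\tilde z,t)ds$, $\bar h_z=\int_0^1\frac{\partial h}{\partial z}(\tilde y,\tilde z,t)ds$, with $\tilde y=sy+(1-s)Y$, $\tilde z=sz+(1-s)Z$. The adjoint variables $\nu^{(y)}(t)\in\mathbb{R}^n$, $\nu^{(z)}(t)\in\mathbb{R}^m$ are continuous on $[0,T]$ (absolutely continuous, equations holding for almost every $t$). *)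

theory Defs
  imports "HOL-Analysis.Analysis"
begin

type_synonym ('n, 'm, 'b) fld = "real^'n \<Rightarrow> real^'m \<Rightarrow> real \<Rightarrow> 'b"

text \<open>Partial derivatives of \<open>F(y,z,t)\<close>. The data are only given for \<open>t \<in> [0,T]\<close>, so the
  \<open>t\<close>-derivative is taken within \<open>[0,T]\<close> (one-sided at the endpoints).\<close>

definition D_y :: "('n::finite, 'm::finite, real^'k::finite) fld \<Rightarrow> ('n, 'm, real^'n^'k) fld" where
  "D_y F u v t = jacobian (\<lambda>u'. F u' v t) (at u)"

definition D_z :: "('n::finite, 'm::finite, real^'k::finite) fld \<Rightarrow> ('n, 'm, real^'m^'k) fld" where
  "D_z F u v t = jacobian (\<lambda>v'. F u v' t) (at v)"

definition D_t :: "real \<Rightarrow> ('n::finite, 'm::finite, 'b::real_normed_vector) fld \<Rightarrow> ('n, 'm, 'b) fld" where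
  "D_t T F u v t = vector_derivative (\<lambda>t'. F u v t') (at t within {0..T})"

definition C1_y_on :: "((real^'n) \<times> (real^'m) \<times> real) set
    \<Rightarrow> ('n::finite, 'm::finite, real^'k::finite) fld \<Rightarrow> bool" where
  "C1_y_on D F \<longleftrightarrow> (\<forall>(u, v, t)\<in>D. (\<lambda>u'. F u' v t) differentiable (at u))
     \<and> continuous_on D (\<lambda>(u, v, t). D_y F u v t)"

definition C1_z_on :: "((real^'n) \<times> (real^'m) \<times> real) set
    \<Rightarrow> ('n::finite, 'm::finite, real^'k::finite) fld \<Rightarrow> bool" where
  "C1_z_on D F \<longleftrightarrow> (\<forall>(u, v, t)\<in>D. (\<lambda>v'. F u v' t) differentiable (at v))
     \<and> continuous_on D (\<lambda>(u, v, t). D_z F u v t)"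

definition C1_t_on :: "real \<Rightarrow> ((real^'n) \<times> (real^'m) \<times> real) set
    \<Rightarrow> ('n::finite, 'm::finite, 'b::real_normed_vector) fld \<Rightarrow> bool" where
  "C1_t_on T D F \<longleftrightarrow> (\<forall>(u, v, t)\<in>D. (\<lambda>t'. F u v t') differentiable (at t within {0..T}))
     \<and> continuous_on D (\<lambda>(u, v, t). D_t T F u v t)"


text \<open>The DAE \<open>y' = f(y,z,t)\<close>, \<open>0 = g(y,z,t)\<close>. The set \<open>D\<close> is the neighborhood of the solution
  (relatively open in \<open>t \<in> [0,T]\<close>) on which the index condition holds.\<close>

definition semi_explicit_index1 :: "((real^'n) \<times> (real^'m) \<times> real) set
    \<Rightarrow> ('n::finite, 'm::finite, real^'m) fld \<Rightarrow> bool" where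
  "semi_explicit_index1 D g \<longleftrightarrow> (\<forall>(u, v, t)\<in>D. invertible (D_z g u v t))"

definition hessenberg_index2 :: "((real^'n) \<times> (real^'m) \<times> real) set
    \<Rightarrow> ('n::finite, 'm::finite, real^'n) fld \<Rightarrow> ('n, 'm, real^'m) fld \<Rightarrow> bool" where
  "hessenberg_index2 D f g \<longleftrightarrow> (\<forall>u v v' t. g u v t = g u v' t)
     \<and> (\<forall>(u, v, t)\<in>D. invertible (D_y g u v t ** D_z f u v t))"

text \<open>The vector \<open>f\<^sup>T g\<^sub>y\<^sub>y f\<close>; the innermost entry is \<open>\<partial>/\<partial>y\<^sub>j (\<partial>g\<^sub>i/\<partial>y\<^sub>k)\<close>.\<close>

definition quad_yy :: "('n::finite, 'm::finite, real^'n) fld \<Rightarrow> ('n, 'm, real^'m) fld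
    \<Rightarrow> ('n, 'm, real^'m) fld" where
  "quad_yy f g u v t = (\<chi> i. \<Sum>j\<in>UNIV. \<Sum>k\<in>UNIV.
     D_y (\<lambda>u v t. D_y g u v t $ i) u v t $ k $ j * f u v t $ j * f u v t $ k)"

definition index_reduced_rhs :: "real \<Rightarrow> ((real^'n) \<times> (real^'m) \<times> real) set
    \<Rightarrow> ('n::finite, 'm::finite, real^'n) fld \<Rightarrow> ('n, 'm, real^'m) fld \<Rightarrow> ('n, 'm, real^'m) fld" where
  "index_reduced_rhs T D f g u v t =
     (if semi_explicit_index1 D g then
        - (matrix_inv (D_z g u v t) *v (D_y g u v t *v f u v t + D_t T g u v t))
      else
        - (matrix_inv (D_y g u v t ** D_z f u v t) *v
            (quad_yy f g u v t
             + D_y g u v t *v (D_y f u v t *v f u v t)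
             + 2 *\<^sub>R (D_t T (D_y g) u v t *v f u v t)
             + D_y g u v t *v D_t T f u v t
             + D_t T (D_t T g) u v t)))"

text \<open>All derivatives appearing in the index condition, in \<open>h\<close> and in the linearized operators
  exist and are continuous. Only index 2 involves \<open>f\<^sub>t\<close>, \<open>g\<^sub>y\<^sub>y\<close>, \<open>g\<^sub>y\<^sub>t\<close>, \<open>g\<^sub>t\<^sub>t\<close>.\<close>

definition smooth_data :: "real \<Rightarrow> ((real^'n) \<times> (real^'m) \<times> real) set
    \<Rightarrow> ('n::finite, 'm::finite, real^'n) fld \<Rightarrow> ('n, 'm, real^'m) fld \<Rightarrow> bool" where
  "smooth_data T D f g \<longleftrightarrow>
     continuous_on D (\<lambda>(u, v, t). f u v t) \<and> C1_y_on D f \<and> C1_z_on D f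
   \<and> continuous_on D (\<lambda>(u, v, t). g u v t) \<and> C1_y_on D g \<and> C1_z_on D g \<and> C1_t_on T D g
   \<and> (hessenberg_index2 D f g \<longrightarrow>
        C1_t_on T D f \<and> (\<forall>i. C1_y_on D (\<lambda>u v t. D_y g u v t $ i))
      \<and> C1_t_on T D (D_y g) \<and> C1_t_on T D (D_t T g))
   \<and> continuous_on D (\<lambda>(u, v, t). index_reduced_rhs T D f g u v t)
   \<and> C1_y_on D (index_reduced_rhs T D f g) \<and> C1_z_on D (index_reduced_rhs T D f g)"

definition dae_solution :: "real \<Rightarrow> ('n::finite, 'm::finite, real^'n) fld \<Rightarrow> ('n, 'm, real^'m) fld
    \<Rightarrow> (real \<Rightarrow> real^'n) \<Rightarrow> (real \<Rightarrow> real^'m) \<Rightarrow> bool" where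
  "dae_solution T f g y z \<longleftrightarrow> z differentiable_on {0..T}
     \<and> (\<forall>t\<in>{0..T}. (y has_vector_derivative f (y t) (z t) t) (at t within {0..T})
                    \<and> g (y t) (z t) t = 0)"


definition bdf1_values :: "real \<Rightarrow> nat \<Rightarrow> ('n::finite, 'm::finite, real^'n) fld
    \<Rightarrow> ('n, 'm, real^'m) fld \<Rightarrow> real^'n \<Rightarrow> real^'m
    \<Rightarrow> (nat \<Rightarrow> real^'n) \<Rightarrow> (nat \<Rightarrow> real^'m) \<Rightarrow> bool" where
  "bdf1_values T N f g y0 z0 Yk Zk \<longleftrightarrow> Yk 0 = y0 \<and> Zk 0 = z0
     \<and> (\<forall>k<N. Yk (Suc k) = Yk k
                 + (T / real N) *\<^sub>R f (Yk (Suc k)) (Zk (Suc k)) (real (Suc k) * (T / real N))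
            \<and> 0 = g (Yk (Suc k)) (Zk (Suc k)) (real (Suc k) * (T / real N)))"

definition pw_linear_interpolant :: "real \<Rightarrow> nat \<Rightarrow> (nat \<Rightarrow> 'a::real_vector) \<Rightarrow> (real \<Rightarrow> 'a) \<Rightarrow> bool" where
  "pw_linear_interpolant T N Xk X \<longleftrightarrow>
     (\<forall>k<N. \<forall>t\<in>{real k * (T / real N) .. real (Suc k) * (T / real N)}.
        X t = Xk k + ((t - real k * (T / real N)) / (T / real N)) *\<^sub>R (Xk (Suc k) - Xk k))"

text \<open>Time derivative on \<open>[0,T]\<close>. For a piecewise linear function its (unspecified) values at the
  nodes do not matter, since it is only used under the integral.\<close>

definition time_deriv :: "real \<Rightarrow> (real \<Rightarrow> 'a::real_normed_vector) \<Rightarrow> real \<Rightarrow> 'a" where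
  "time_deriv T X t = vector_derivative X (at t within {0..T})"


definition L2_on :: "real \<Rightarrow> (real \<Rightarrow> 'a::euclidean_space) \<Rightarrow> bool" where
  "L2_on T \<psi> \<longleftrightarrow> set_borel_measurable lebesgue {0..T} \<psi>
     \<and> set_integrable lebesgue {0..T} (\<lambda>t. (norm (\<psi> t))\<^sup>2)"

definition L2_inner :: "real \<Rightarrow> (real \<Rightarrow> 'a::euclidean_space) \<Rightarrow> (real \<Rightarrow> 'a) \<Rightarrow> real" where
  "L2_inner T a b = (LINT t:{0..T}|lebesgue. a t \<bullet> b t)"

definition QoI :: "real \<Rightarrow> (real \<Rightarrow> 'a::euclidean_space) \<Rightarrow> (real \<Rightarrow> 'b::euclidean_space)
    \<Rightarrow> (real \<Rightarrow> 'a) \<Rightarrow> (real \<Rightarrow> 'b) \<Rightarrow> real" where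
  "QoI T \<psi>y \<psi>z y z = L2_inner T y \<psi>y + L2_inner T z \<psi>z"

definition seg_pt :: "real \<Rightarrow> 'a \<Rightarrow> 'a \<Rightarrow> 'a::real_vector" where
  "seg_pt s a A = s *\<^sub>R a + (1 - s) *\<^sub>R A"

definition mean_jac :: "('n::finite, 'm::finite, 'b::real_normed_vector) fld
    \<Rightarrow> (real \<Rightarrow> real^'n) \<Rightarrow> (real \<Rightarrow> real^'m) \<Rightarrow> (real \<Rightarrow> real^'n) \<Rightarrow> (real \<Rightarrow> real^'m) \<Rightarrow> real \<Rightarrow> 'b" where
  "mean_jac J y z Y Z t =
     integral {0..1} (\<lambda>s. J (seg_pt s (y t) (Y t)) (seg_pt s (z t) (Z t)) t)"

text \<open>Absolute continuity on \<open>[a,b]\<close>. The members of a division are compact intervals with pairwise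
  disjoint interiors; \<open>Inf K\<close> and \<open>Sup K\<close> are the endpoints of \<open>K\<close>.\<close>

definition abs_continuous_on :: "real \<Rightarrow> real \<Rightarrow> (real \<Rightarrow> 'a::real_normed_vector) \<Rightarrow> bool" where
  "abs_continuous_on a b X \<longleftrightarrow>
     (\<forall>\<epsilon>>0. \<exists>\<delta>>0. \<forall>\<D> S. \<D> division_of S \<and> S \<subseteq> {a..b} \<and> (\<Sum>K\<in>\<D>. Sup K - Inf K) < \<delta>
        \<longrightarrow> (\<Sum>K\<in>\<D>. norm (X (Sup K) - X (Inf K))) < \<epsilon>)"

definition adjoint_solution :: "real \<Rightarrow> ('n::finite, 'm::finite, real^'n) fld \<Rightarrow> ('n, 'm, real^'m) fld
    \<Rightarrow> (real \<Rightarrow> real^'n) \<Rightarrow> (real \<Rightarrow> real^'m) \<Rightarrow> (real \<Rightarrow> real^'n) \<Rightarrow> (real \<Rightarrow> real^'m)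
    \<Rightarrow> (real \<Rightarrow> real^'n) \<Rightarrow> (real \<Rightarrow> real^'m) \<Rightarrow> (real \<Rightarrow> real^'n) \<Rightarrow> (real \<Rightarrow> real^'m) \<Rightarrow> bool" where
  "adjoint_solution T f h y z Y Z \<psi>y \<psi>z \<nu>y \<nu>z \<longleftrightarrow>
     abs_continuous_on 0 T \<nu>y \<and> abs_continuous_on 0 T \<nu>z
   \<and> (AE t in lebesgue. t \<in> {0..T} \<longrightarrow>
        (\<nu>y has_vector_derivative
           - (transpose (mean_jac (D_y f) y z Y Z t) *v \<nu>y t
              + transpose (mean_jac (D_y h) y z Y Z t) *v \<nu>z t + \<psi>y t)) (at t within {0..T})
      \<and> (\<nu>z has_vector_derivative
           - (transpose (mean_jac (D_z f) y z Y Z t) *v \<nu>y t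
              + transpose (mean_jac (D_z h) y z Y Z t) *v \<nu>z t + \<psi>z t)) (at t within {0..T}))
   \<and> \<nu>y T = 0 \<and> \<nu>z T = 0"

end

theory Submission
  imports Defs
begin

text \<open>The error \<open>e = (e\<^sup>y, e\<^sup>z)\<close> satisfies an exact linear equation whose adjoint is solved by
  \<open>\<nu> = (\<nu>\<^sup>y, \<nu>\<^sup>z)\<close>. Differentiating the algebraic constraint along the true solution shows that
  \<open>z' = h(y,z,t)\<close> (\<open>index_reduced_ode\<close>). Subtracting \<open>Y'\<close> and \<open>Z'\<close> from \<open>f(y,z,t)\<close> and
  \<open>h(y,z,t)\<close> and writing the differences \<open>f(y,z,t) - f(Y,Z,t)\<close> and \<open>h(y,z,t) - h(Y,Z,t)\<close>
  through the averaged Jacobians (\<open>mean_value_mean_jac\<close>) gives, away from the nodes,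
  \<open>e' = J e + R\<close>, where \<open>R\<close> is the residual \<open>(f(Y,Z) - Y', h(Y,Z) - Z')\<close>. Together with
  \<open>- \<nu>' = J\<^sup>T \<nu> + \<psi>\<close> this yields almost everywhere \<open>(\<nu> \<bullet> e)' = \<nu> \<bullet> R - e \<bullet> \<psi>\<close>, and
  integrating over \<open>[0,T]\<close> with \<open>\<nu>(T) = 0\<close> is the error representation.

  Two points need care. First, the adjoint equations hold only almost everywhere, so the integration
  uses the fundamental theorem of calculus for absolutely continuous functions
  (\<open>fundamental_theorem_of_calculus_abs_continuous\<close>); \<open>e\<close> is Lipschitz, hence
  \<open>\<nu> \<bullet> e\<close> is absolutely continuous. Secondly, smoothness of the data is given through
  continuous partial derivatives, which are first combined into a chain rule along curves
  (\<open>has_vector_derivative_continuous_partials\<close>). For index 2 the constraint is differentiated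
  twice, and this requires the \<open>y\<close>-derivative of \<open>g\<^sub>t\<close>, which is obtained from the time derivative of
  \<open>g\<^sub>y\<close> by a version of Schwarz's theorem (\<open>mixed_partial_exchange\<close>).\<close>


section \<open>Absolutely continuous functions\<close>

text \<open>Gauge integration works with tagged partial divisions, while absolute continuity is phrased with
  divisions of small total length. For intervals with disjoint interiors that length is the
  measure of the union, so a bound on the measure suffices.\<close>
lemma abs_continuous_sum_bound:
  fixes X :: "real \<Rightarrow> 'a::real_normed_vector"
  assumes ac: "abs_continuous_on a b X" and "e > 0"
  shows "\<exists>d>0. \<forall>p. p tagged_partial_division_of {a..b} \<longrightarrow>
     measure lebesgue (\<Union>(snd ` p)) < d \<longrightarrow> (\<Sum>(x,K)\<in>p. norm (X (Sup K) - X (Inf K))) < e"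
proof -
  obtain d where "d > 0" and d: "\<And>\<D> S. \<D> division_of S \<Longrightarrow> S \<subseteq> {a..b} \<Longrightarrow> (\<Sum>K\<in>\<D>. Sup K - Inf K) < d
        \<Longrightarrow> (\<Sum>K\<in>\<D>. norm (X (Sup K) - X (Inf K))) < e"
    using ac \<open>e > 0\<close> unfolding abs_continuous_on_def by meson
  show ?thesis
  proof (intro exI[of _ d] conjI \<open>d > 0\<close> allI impI)
    fix p assume p: "p tagged_partial_division_of {a..b}"
      and small: "measure lebesgue (\<Union>(snd ` p)) < d"
    \<comment> \<open>The extrema of the empty set are unspecified, so it needs its own value
      before the sum over the tagged division can be turned into a sum over its intervals.\<close>
    define V where "V K = (if K = {} then 0 else norm (X (Sup K) - X (Inf K)))" for K
    have div: "snd ` p division_of \<Union>(snd ` p)"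
      using p by (rule partial_division_of_tagged_division)
    have tag: "p tagged_division_of \<Union>(snd ` p)"
      using p by (rule tagged_partial_division_of_Union_self)
    have sub: "\<Union>(snd ` p) \<subseteq> {a..b}"
      using tagged_partial_division_ofD(3)[OF p] by force
    have "(\<Sum>K\<in>snd ` p. Sup K - Inf K) = (\<Sum>K\<in>snd ` p. measure lebesgue K)"
    proof (rule sum.cong[OF refl])
      fix K assume "K \<in> snd ` p"
      then obtain u v where "K = cbox u v" "K \<noteq> {}" using division_ofD(3,4)[OF div] by blast
      then show "Sup K - Inf K = measure lebesgue K" by simp
    qed
    also have "\<dots> = measure lebesgue (\<Union>(snd ` p))"
      by (rule content_division[OF div])
    finally have "(\<Sum>K\<in>snd ` p. norm (X (Sup K) - X (Inf K))) < e"
      using d[OF div sub] small by simp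
    also have "(\<Sum>K\<in>snd ` p. norm (X (Sup K) - X (Inf K))) = sum V (snd ` p)"
      using division_ofD(3)[OF div] by (intro sum.cong) (auto simp: V_def)
    also have "sum V (snd ` p) = (\<Sum>(x,K)\<in>p. V K)"
      by (rule sum.over_tagged_division_lemma[OF tag, symmetric]) (auto simp: V_def)
    also have "\<dots> = (\<Sum>(x,K)\<in>p. norm (X (Sup K) - X (Inf K)))"
      using tagged_division_ofD(2)[OF tag] by (intro sum.cong) (auto simp: V_def, blast)
    finally show "(\<Sum>(x,K)\<in>p. norm (X (Sup K) - X (Inf K))) < e" .
  qed
qed

text \<open>Cover the null set \<open>E\<close> by an open set of small measure and let the gauge confine cells tagged in \<open>E\<close> to it:
  absolute continuity makes the increments of \<open>X\<close> over these cells small in total. On a cell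
  tagged outside \<open>E\<close>, differentiability at the tag makes the increment differ from
  (length) times (derivative) by at most \<open>c\<close> times the length, and these errors add up to at most
  \<open>c * (b - a)\<close>. Putting the derivative to \<open>0\<close> on \<open>E\<close> changes no integral.\<close>
theorem fundamental_theorem_of_calculus_abs_continuous:
  fixes X :: "real \<Rightarrow> 'a::euclidean_space"
  assumes "a \<le> b" and ac: "abs_continuous_on a b X" and "negligible E"
    and der: "\<And>t. t \<in> {a..b} - E \<Longrightarrow> (X has_vector_derivative X' t) (at t within {a..b})"
  shows "(X' has_integral (X b - X a)) {a..b}"
proof -
  have outer_open: "\<exists>U. open U \<and> E \<subseteq> U \<and> U \<in> lmeasurable \<and> measure lebesgue U < d" if d0: "d > 0" for d
  proof -
    have E: "E \<in> null_sets lebesgue" using \<open>negligible E\<close> by (simp add: negligible_iff_null_sets)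
    obtain U where U: "open U" "E \<subseteq> U" "U - E \<in> lmeasurable" "emeasure lebesgue (U - E) < ennreal d"
      using sets_lebesgue_outer_open[OF _ d0, of E] null_setsD2[OF E] by blast
    have "measure lebesgue (U - E) < d"
      using U(3,4) d0 by (simp add: emeasure_eq_measure2 ennreal_less_iff)
    moreover have "U \<in> lmeasurable"
      using fmeasurable.Un[OF U(3) fmeasurableI_null_sets[OF E]] U(2) by (simp add: Un_absorb2)
    moreover have "measure lebesgue (U - E) = measure lebesgue U"
      using E U(1) by (intro measure_Diff_null_set) auto
    ultimately show ?thesis using U by auto
  qed
  define G where "G t = (if t \<in> E then 0 else X' t)" for t
  have "(G has_integral (X b - X a)) (cbox a b)"
    unfolding has_integral
  proof (intro allI impI)
    fix e :: real assume "e > 0"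
    \<comment> \<open>The summand 1 keeps the constant meaningful when the interval is a single
      point.\<close>
    define c where "c = e / (2 * (b - a + 1))"
    have "c > 0" using \<open>e > 0\<close> \<open>a \<le> b\<close> by (simp add: c_def)
    have cba: "c * (b - a) \<le> e / 2" using \<open>e > 0\<close> \<open>a \<le> b\<close> by (simp add: c_def field_simps)
    obtain d where "d > 0" and d: "\<And>p. p tagged_partial_division_of {a..b} \<Longrightarrow>
       measure lebesgue (\<Union>(snd ` p)) < d \<Longrightarrow> (\<Sum>(x,K)\<in>p. norm (X (Sup K) - X (Inf K))) < e / 2"
      using abs_continuous_sum_bound[OF ac half_gt_zero[OF \<open>e > 0\<close>]] by blast
    obtain U where U: "open U" "E \<subseteq> U" "U \<in> lmeasurable" "measure lebesgue U < d"
      using outer_open[OF \<open>d > 0\<close>] by blast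
    have "\<forall>t. \<exists>r>0. t \<in> {a..b} - E \<longrightarrow>
       (\<forall>s\<in>{a..b}. norm (s - t) < r \<longrightarrow> norm (X s - X t - (s - t) *\<^sub>R X' t) \<le> c * norm (s - t))"
    proof
      fix t
      show "\<exists>r>0. t \<in> {a..b} - E \<longrightarrow>
       (\<forall>s\<in>{a..b}. norm (s - t) < r \<longrightarrow> norm (X s - X t - (s - t) *\<^sub>R X' t) \<le> c * norm (s - t))"
      proof (cases "t \<in> {a..b} - E")
        case True
        from der[OF this] \<open>c > 0\<close> show ?thesis
          unfolding has_vector_derivative_def has_derivative_within_alt by blast
      qed (use zero_less_one in blast)
    qed
    from choice[OF this] obtain r where r': "\<forall>t. r t > 0 \<and> (t \<in> {a..b} - E \<longrightarrow> (\<forall>s\<in>{a..b}.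
        norm (s - t) < r t \<longrightarrow> norm (X s - X t - (s - t) *\<^sub>R X' t) \<le> c * norm (s - t)))"
      by (elim exE) (rule that)
    then have r0: "\<And>t. r t > 0" and r: "\<And>t s. t \<in> {a..b} - E \<Longrightarrow> s \<in> {a..b} \<Longrightarrow>
        norm (s - t) < r t \<Longrightarrow> norm (X s - X t - (s - t) *\<^sub>R X' t) \<le> c * norm (s - t)"
      by simp_all
    define \<gamma> where "\<gamma> t = (if t \<in> E then U else ball t (r t))" for t
    have "gauge \<gamma>" using U r0 by (auto simp: gauge_def \<gamma>_def)
    moreover have "norm ((\<Sum>(x,K)\<in>p. measure lborel K *\<^sub>R G x) - (X b - X a)) < e"
      if p: "p tagged_division_of cbox a b" and fine: "\<gamma> fine p" for p
    proof -
      define q where "q = {(x,K) \<in> p. x \<in> E}"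
      have finp: "finite p" using p by blast
      have qp: "q \<subseteq> p" by (auto simp: q_def)
      have ba: "b - a = (\<Sum>(x,K)\<in>p. Sup K - Inf K)" "X b - X a = (\<Sum>(x,K)\<in>p. X(Sup K) - X(Inf K))"
        using additive_tagged_division_1[where f= "\<lambda>x. x"] additive_tagged_division_1[where f= X]
            \<open>a \<le> b\<close> p by auto
      have qpart: "q tagged_partial_division_of {a..b}"
        using p tagged_partial_division_subset[OF _ qp] unfolding tagged_division_of_def by simp
      have "(\<Sum>(x,K)\<in>q. norm (measure lborel K *\<^sub>R G x - (X(Sup K) - X(Inf K))))
          = (\<Sum>(x,K)\<in>q. norm (X(Sup K) - X(Inf K)))"
        by (rule sum.cong) (auto simp: q_def G_def norm_minus_commute)
      also have "\<dots> < e / 2"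
      proof (rule d[OF qpart])
        have "\<Union>(snd ` q) \<subseteq> U" using fineD[OF fine] by (force simp: q_def \<gamma>_def)
        moreover have "\<Union>(snd ` q) \<in> lmeasurable"
          using partial_division_of_tagged_division[OF qpart] by (rule lmeasurable_division)
        ultimately show "measure lebesgue (\<Union>(snd ` q)) < d"
          using measure_mono_fmeasurable[OF _ fmeasurableD U(3)] U(4) by (meson le_less_trans)
      qed
      finally have 1: "(\<Sum>(x,K)\<in>q. norm (measure lborel K *\<^sub>R G x - (X(Sup K) - X(Inf K)))) < e / 2" .
      have bound: "norm (measure lborel K *\<^sub>R G x - (X(Sup K) - X(Inf K))) \<le> c * (Sup K - Inf K)"
        if xK: "(x,K) \<in> p" "x \<notin> E" for x K
      proof -
        have "x \<in> K" "K \<subseteq> {a..b}" using tagged_division_ofD(2,3)[OF p xK(1)] by auto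
        moreover obtain u v where "K = cbox u v" using tagged_division_ofD(4)[OF p xK(1)] by blast
        ultimately have K: "K = {u..v}" "u \<le> x" "x \<le> v" "u \<in> {a..b}" "v \<in> {a..b}" "x \<in> {a..b}" by auto
        have "K \<subseteq> ball x (r x)" using fineD[OF fine xK(1)] xK(2) by (simp add: \<gamma>_def)
        then have "u \<in> ball x (r x)" "v \<in> ball x (r x)" using K(1-3) by (auto simp del: mem_ball)
        then have uv: "norm (u - x) < r x" "norm (v - x) < r x" by (auto simp: dist_norm norm_minus_commute)
        have x: "x \<in> {a..b} - E" using K xK by simp
        have "norm (measure lborel K *\<^sub>R G x - (X(Sup K) - X(Inf K)))
            = norm ((X u - X x - (u - x) *\<^sub>R X' x) - (X v - X x - (v - x) *\<^sub>R X' x))"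
          using K xK by (simp add: G_def algebra_simps)
        also have "\<dots> \<le> c * norm (u - x) + c * norm (v - x)"
          by (rule order_trans[OF norm_triangle_ineq4 add_mono[OF r[OF x K(4) uv(1)] r[OF x K(5) uv(2)]]])
        also have "\<dots> = c * (Sup K - Inf K)" using K by (simp add: algebra_simps)
        finally show "norm (measure lborel K *\<^sub>R G x - (X(Sup K) - X(Inf K))) \<le> c * (Sup K - Inf K)" .
      qed
      have nonneg': "0 \<le> Sup K - Inf K" if xK: "(x,K) \<in> p" for x K
      proof -
        obtain u v where "K = cbox u v" "x \<in> K" using tagged_division_ofD(2,4)[OF p xK] by blast
        then show ?thesis by auto
      qed
      have "(\<Sum>(x,K)\<in>p - q. norm (measure lborel K *\<^sub>R G x - (X(Sup K) - X(Inf K))))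
          \<le> (\<Sum>(x,K)\<in>p - q. c * (Sup K - Inf K))"
        by (rule sum_mono) (use bound in \<open>auto simp: q_def\<close>)
      also have "\<dots> \<le> (\<Sum>(x,K)\<in>p. c * (Sup K - Inf K))"
        by (rule sum_mono2[OF finp]) (use nonneg' \<open>c > 0\<close> in auto)
      also have "\<dots> = c * (b - a)"
        by (simp add: ba(1) sum_distrib_left case_prod_unfold)
      finally have 2: "(\<Sum>(x,K)\<in>p - q. norm (measure lborel K *\<^sub>R G x - (X(Sup K) - X(Inf K)))) \<le> e / 2"
        using cba by linarith
      have "norm ((\<Sum>(x,K)\<in>p. measure lborel K *\<^sub>R G x) - (X b - X a))
          = norm (\<Sum>(x,K)\<in>p. measure lborel K *\<^sub>R G x - (X(Sup K) - X(Inf K)))"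
        by (simp add: ba(2) sum_subtractf case_prod_unfold)
      also have "\<dots> \<le> (\<Sum>(x,K)\<in>p. norm (measure lborel K *\<^sub>R G x - (X(Sup K) - X(Inf K))))"
        using norm_sum[of "\<lambda>(x,K). measure lborel K *\<^sub>R G x - (X(Sup K) - X(Inf K))" p]
        by (simp add: case_prod_unfold)
      also have "\<dots> = (\<Sum>(x,K)\<in>p - q. norm (measure lborel K *\<^sub>R G x - (X(Sup K) - X(Inf K))))
           + (\<Sum>(x,K)\<in>q. norm (measure lborel K *\<^sub>R G x - (X(Sup K) - X(Inf K))))"
        by (rule sum.subset_diff[OF qp finp])
      also have "\<dots> < e" using 1 2 by linarith
      finally show ?thesis .
    qed
    ultimately show "\<exists>\<gamma>. gauge \<gamma> \<and> (\<forall>p. p tagged_division_of cbox a b \<and> \<gamma> fine p \<longrightarrow>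
        norm ((\<Sum>(x,K)\<in>p. measure lborel K *\<^sub>R G x) - (X b - X a)) < e)"
      by (intro exI[of _ \<gamma>]) simp
  qed
  then have "(G has_integral (X b - X a)) {a..b}" by simp
  then show ?thesis
    by (rule has_integral_spike[OF \<open>negligible E\<close>, rotated]) (simp add: G_def)
qed

lemma lipschitz_imp_abs_continuous:
  assumes "L-lipschitz_on {a..b} X"
  shows "abs_continuous_on a b X"
  unfolding abs_continuous_on_def
proof (intro allI impI)
  fix e :: real assume "e > 0"
  have "L \<ge> 0" using assms by (rule lipschitz_on_nonneg)
  show "\<exists>d>0. \<forall>\<D> S. \<D> division_of S \<and> S \<subseteq> {a..b} \<and> (\<Sum>K\<in>\<D>. Sup K - Inf K) < d
      \<longrightarrow> (\<Sum>K\<in>\<D>. norm (X (Sup K) - X (Inf K))) < e"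
  proof (intro exI[of _ "e / (L + 1)"] conjI allI impI; (elim conjE)?)
    show "e / (L + 1) > 0" using \<open>e > 0\<close> \<open>L \<ge> 0\<close> by simp
    fix \<D> S assume div: "\<D> division_of S" "S \<subseteq> {a..b}" and small: "(\<Sum>K\<in>\<D>. Sup K - Inf K) < e / (L + 1)"
    have K: "norm (X (Sup K) - X (Inf K)) \<le> (L + 1) * (Sup K - Inf K)" if KD: "K \<in> \<D>" for K
    proof -
      obtain u v where "K = cbox u v" "K \<noteq> {}" "K \<subseteq> {a..b}"
        using division_ofD(2,3,4)[OF div(1) KD] div(2) by blast
      then have uv: "K = {u..v}" "u \<le> v" "u \<in> {a..b}" "v \<in> {a..b}" by auto
      have "norm (X v - X u) \<le> L * (v - u)"
        using lipschitz_on_normD[OF assms uv(4,3)] uv(2) by simp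
      also have "\<dots> \<le> (L + 1) * (v - u)" using uv(2) by (intro mult_right_mono) auto
      finally show ?thesis using uv by simp
    qed
    have "(\<Sum>K\<in>\<D>. norm (X (Sup K) - X (Inf K))) \<le> (L + 1) * (\<Sum>K\<in>\<D>. Sup K - Inf K)"
      unfolding sum_distrib_left by (rule sum_mono) (rule K)
    also have "\<dots> < e" using small \<open>L \<ge> 0\<close> by (simp add: field_simps)
    finally show "(\<Sum>K\<in>\<D>. norm (X (Sup K) - X (Inf K))) < e" .
  qed
qed

lemma abs_continuous_imp_continuous:
  assumes "abs_continuous_on a b X"
  shows "continuous_on {a..b} X"
  unfolding continuous_on_iff
proof (intro ballI allI impI)
  fix x and e :: real assume x: "x \<in> {a..b}" and "e > 0"
  obtain d where "d > 0" and d: "\<And>\<D> S. \<D> division_of S \<and> S \<subseteq> {a..b} \<and> (\<Sum>K\<in>\<D>. Sup K - Inf K) < d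
        \<longrightarrow> (\<Sum>K\<in>\<D>. norm (X (Sup K) - X (Inf K))) < e"
    using assms \<open>e > 0\<close> unfolding abs_continuous_on_def by meson
  have close: "dist (X u) (X v) < e" if "u \<in> {a..b}" "v \<in> {a..b}" "u \<le> v" "v - u < d" for u v
  proof -
    have "{{u..v}} division_of {u..v}" using division_of_self[of u v] that(3) by simp
    then show ?thesis using d[of "{{u..v}}" "{u..v}"] that by (simp add: dist_norm norm_minus_commute)
  qed
  show "\<exists>d>0. \<forall>x'\<in>{a..b}. dist x' x < d \<longrightarrow> dist (X x') (X x) < e"
  proof (intro exI[of _ d] conjI ballI impI \<open>d > 0\<close>)
    fix x' assume x': "x' \<in> {a..b}" "dist x' x < d"
    show "dist (X x') (X x) < e"
      using close[OF x'(1) x] close[OF x x'(1)] x'(2) by (cases "x' \<le> x") (auto simp: dist_real_def dist_commute)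
  qed
qed

text \<open>The increment of \<open>p \<bullet> q\<close> splits as \<open>\<Delta>p \<bullet> q + p \<bullet> \<Delta>q\<close>, and both factors are bounded, being
  continuous on a compact interval.\<close>
lemma abs_continuous_inner:
  fixes p q :: "real \<Rightarrow> 'a::real_inner"
  assumes p: "abs_continuous_on a b p" and q: "abs_continuous_on a b q"
  shows "abs_continuous_on a b (\<lambda>t. p t \<bullet> q t)"
  unfolding abs_continuous_on_def
proof (intro allI impI)
  fix e :: real assume "e > 0"
  have "bounded (p ` {a..b} \<union> q ` {a..b})"
    using abs_continuous_imp_continuous[OF p] abs_continuous_imp_continuous[OF q]
    by (auto intro!: compact_imp_bounded compact_continuous_image)
  then obtain B where "B > 0" and B: "\<And>x. x \<in> p ` {a..b} \<union> q ` {a..b} \<Longrightarrow> norm x \<le> B"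
    unfolding bounded_pos by blast
  have "e / (2 * B) > 0" using \<open>e > 0\<close> \<open>B > 0\<close> by simp
  obtain d1 where "d1 > 0" and d1: "\<And>\<D> S. \<D> division_of S \<and> S \<subseteq> {a..b} \<and> (\<Sum>K\<in>\<D>. Sup K - Inf K) < d1
        \<longrightarrow> (\<Sum>K\<in>\<D>. norm (p (Sup K) - p (Inf K))) < e / (2 * B)"
    using p \<open>e / (2 * B) > 0\<close> unfolding abs_continuous_on_def by meson
  obtain d2 where "d2 > 0" and d2: "\<And>\<D> S. \<D> division_of S \<and> S \<subseteq> {a..b} \<and> (\<Sum>K\<in>\<D>. Sup K - Inf K) < d2
        \<longrightarrow> (\<Sum>K\<in>\<D>. norm (q (Sup K) - q (Inf K))) < e / (2 * B)"
    using q \<open>e / (2 * B) > 0\<close> unfolding abs_continuous_on_def by meson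
  show "\<exists>d>0. \<forall>\<D> S. \<D> division_of S \<and> S \<subseteq> {a..b} \<and> (\<Sum>K\<in>\<D>. Sup K - Inf K) < d
      \<longrightarrow> (\<Sum>K\<in>\<D>. norm (p (Sup K) \<bullet> q (Sup K) - p (Inf K) \<bullet> q (Inf K))) < e"
  proof (intro exI[of _ "min d1 d2"] conjI allI impI; (elim conjE)?)
    show "min d1 d2 > 0" using \<open>d1 > 0\<close> \<open>d2 > 0\<close> by simp
    fix \<D> S assume div: "\<D> division_of S" "S \<subseteq> {a..b}" and small: "(\<Sum>K\<in>\<D>. Sup K - Inf K) < min d1 d2"
    have K: "norm (p (Sup K) \<bullet> q (Sup K) - p (Inf K) \<bullet> q (Inf K))
        \<le> B * norm (p (Sup K) - p (Inf K)) + B * norm (q (Sup K) - q (Inf K))" if KD: "K \<in> \<D>" for K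
    proof -
      obtain u v where "K = cbox u v" "K \<noteq> {}" "K \<subseteq> {a..b}"
        using division_ofD(2,3,4)[OF div(1) KD] div(2) by blast
      then have uv: "K = {u..v}" "u \<le> v" "u \<in> {a..b}" "v \<in> {a..b}" by auto
      have "p v \<bullet> q v - p u \<bullet> q u = (p v - p u) \<bullet> q v + p u \<bullet> (q v - q u)"
        by (simp add: inner_diff_left inner_diff_right)
      also have "norm \<dots> \<le> norm (p v - p u) * norm (q v) + norm (p u) * norm (q v - q u)"
        by (rule order_trans[OF norm_triangle_ineq add_mono]) (simp_all add: Cauchy_Schwarz_ineq2)
      also have "\<dots> \<le> norm (p v - p u) * B + B * norm (q v - q u)"
        using B[of "q v"] B[of "p u"] uv \<open>B > 0\<close> by (intro add_mono mult_mono) auto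
      finally show ?thesis using uv by (simp add: mult.commute)
    qed
    have "(\<Sum>K\<in>\<D>. norm (p (Sup K) \<bullet> q (Sup K) - p (Inf K) \<bullet> q (Inf K)))
      \<le> B * (\<Sum>K\<in>\<D>. norm (p (Sup K) - p (Inf K))) + B * (\<Sum>K\<in>\<D>. norm (q (Sup K) - q (Inf K)))"
      unfolding sum_distrib_left sum.distrib[symmetric] by (rule sum_mono) (rule K)
    also have "\<dots> < B * (e / (2 * B)) + B * (e / (2 * B))"
      using d1[of \<D> S] d2[of \<D> S] div small \<open>B > 0\<close>
      by (intro add_strict_mono mult_strict_left_mono) auto
    also have "\<dots> = e" using \<open>B > 0\<close> by simp
    finally show "(\<Sum>K\<in>\<D>. norm (p (Sup K) \<bullet> q (Sup K) - p (Inf K) \<bullet> q (Inf K))) < e" .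
  qed
qed

lemma lipschitz_on_of_continuous_derivative:
  fixes X :: "real \<Rightarrow> 'a::real_normed_vector"
  assumes X: "\<And>t. t \<in> {a..b} \<Longrightarrow> (X has_vector_derivative X' t) (at t within {a..b})"
    and X': "continuous_on {a..b} X'"
  shows "\<exists>L. L-lipschitz_on {a..b} X"
proof -
  have "bounded (X' ` {a..b})" using X' by (auto intro!: compact_imp_bounded compact_continuous_image)
  then obtain B where "B > 0" and B: "\<And>t. t \<in> {a..b} \<Longrightarrow> norm (X' t) \<le> B"
    unfolding bounded_pos by blast
  have "B-lipschitz_on {a..b} X"
  proof (rule lipschitz_onI)
    fix s t assume st: "s \<in> {a..b}" "t \<in> {a..b}"
    have "norm (X s - X t) \<le> B * norm (s - t)"
    proof (rule differentiable_bound[of "{a..b}" _ "\<lambda>t d. d *\<^sub>R X' t"])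
      show "(X has_derivative (\<lambda>d. d *\<^sub>R X' t)) (at t within {a..b})" if "t \<in> {a..b}" for t
        using X[OF that] by (simp add: has_vector_derivative_def)
      show "onorm (\<lambda>d. d *\<^sub>R X' t) \<le> B" if "t \<in> {a..b}" for t
        by (rule onorm_bound) (use B[OF that] \<open>B > 0\<close> in \<open>auto simp: mult.commute[of B] intro!: mult_left_mono\<close>)
    qed (use st in auto)
    then show "dist (X s) (X t) \<le> B * dist s t" by (simp add: dist_norm)
  qed (use \<open>B > 0\<close> in simp)
  then show ?thesis by blast
qed

section \<open>Chain rule and mixed derivatives from continuous partial derivatives\<close>

lemma openin_box_within_strip:
  fixes y :: "'a::real_normed_vector" and z :: "'b::real_normed_vector"
  assumes "openin (top_of_set (UNIV \<times> UNIV \<times> S)) D" "(y, z, t) \<in> D"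
  obtains r where "r > 0" "ball y r \<times> ball z r \<times> (S \<inter> ball t r) \<subseteq> D"
proof -
  obtain W where W: "open W" "D = (UNIV \<times> UNIV \<times> S) \<inter> W"
    using assms(1) by (auto simp: openin_open)
  then have "(y, z, t) \<in> W" using assms(2) by auto
  obtain A B where AB: "open A" "open B" "(y, z, t) \<in> A \<times> B" "A \<times> B \<subseteq> W"
    by (rule open_prod_elim[OF \<open>open W\<close> \<open>(y, z, t) \<in> W\<close>])
  have "(z, t) \<in> B" using AB by simp
  obtain B1 B2 where B: "open B1" "open B2" "(z, t) \<in> B1 \<times> B2" "B1 \<times> B2 \<subseteq> B"
    by (rule open_prod_elim[OF \<open>open B\<close> \<open>(z, t) \<in> B\<close>])
  obtain r1 where r1: "r1 > 0" "ball y r1 \<subseteq> A" using AB by (meson SigmaD1 open_contains_ball)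
  obtain r2 where r2: "r2 > 0" "ball z r2 \<subseteq> B1" using B by (meson SigmaD1 open_contains_ball)
  obtain r3 where r3: "r3 > 0" "ball t r3 \<subseteq> B2" using B by (meson SigmaD2 open_contains_ball)
  define r where "r = min r1 (min r2 r3)"
  have "ball y r \<subseteq> A" "ball z r \<subseteq> B1" "ball t r \<subseteq> B2"
    using r1(2) r2(2) r3(2) by (auto simp: r_def)
  then have "ball y r \<times> ball z r \<times> (S \<inter> ball t r) \<subseteq> D"
    using AB(4) B(4) unfolding W(2) by blast
  moreover have "r > 0" using r1 r2 r3 by (simp add: r_def)
  ultimately show ?thesis using that by blast
qed

text \<open>The data only have partial derivatives, and the one in \<open>t\<close> is one-sided at the ends of the time
  interval. The total derivative is assembled by adding one group of variables at a time. In each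
  such step only the derivative in the added variable has to be continuous; adding \<open>t\<close> first
  leaves it with mere differentiability at the given point. On a small box every slice through the open set \<open>D\<close>
  is convex.\<close>
lemma has_vector_derivative_continuous_partials:
  fixes F :: "'a::euclidean_space \<Rightarrow> 'b::euclidean_space \<Rightarrow> real \<Rightarrow> 'c::real_normed_vector"
    and Fy :: "'a \<Rightarrow> 'b \<Rightarrow> real \<Rightarrow> 'a \<Rightarrow>\<^sub>L 'c" and Fz :: "'a \<Rightarrow> 'b \<Rightarrow> real \<Rightarrow> 'b \<Rightarrow>\<^sub>L 'c"
  assumes D: "openin (top_of_set (UNIV \<times> UNIV \<times> S)) D" and t: "t \<in> S" "(y t, z t, t) \<in> D"
    and Fy: "\<And>u v s. (u, v, s) \<in> D \<Longrightarrow> ((\<lambda>u'. F u' v s) has_derivative Fy u v s) (at u)"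
    and Fz: "\<And>u v s. (u, v, s) \<in> D \<Longrightarrow> ((\<lambda>v'. F u v' s) has_derivative Fz u v s) (at v)"
    and cont_y: "continuous_on D (\<lambda>(u, v, s). Fy u v s)"
    and cont_z: "continuous_on D (\<lambda>(u, v, s). Fz u v s)"
    and Ft: "((\<lambda>s. F (y t) (z t) s) has_vector_derivative Ft) (at t within S)"
    and y: "(y has_vector_derivative y') (at t within S)"
    and z: "(z has_vector_derivative z') (at t within S)"
  shows "((\<lambda>s. F (y s) (z s) s) has_vector_derivative
     Fy (y t) (z t) t y' + Fz (y t) (z t) t z' + Ft) (at t within S)"
proof -
  obtain r where r: "r > 0" "ball (y t) r \<times> ball (z t) r \<times> (S \<inter> ball t r) \<subseteq> D"
    using openin_box_within_strip[OF D t(2)] by blast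
  let ?U = "ball (y t) r" and ?V = "ball (z t) r" and ?J = "S \<inter> ball t r"
  have mem: "(u, v, s) \<in> D" if "u \<in> ?U" "v \<in> ?V" "s \<in> ?J" for u v s
    using r(2) that by blast
  have cen: "y t \<in> ?U" "z t \<in> ?V" "t \<in> ?J" using r(1) t by auto
  have "((\<lambda>(s, v). F (y t) v s) has_derivative
      (\<lambda>(ds, dv). ds *\<^sub>R Ft + Fz (y t) (z t) t dv)) (at (t, z t) within ?J \<times> ?V)"
  proof (rule has_derivative_partialsI[where fx = "\<lambda>ds. ds *\<^sub>R Ft" and fy = "\<lambda>s v. Fz (y t) v s"])
    show "((\<lambda>s. F (y t) (z t) s) has_derivative (\<lambda>ds. ds *\<^sub>R Ft)) (at t within ?J)"
      using Ft unfolding has_vector_derivative_def by (rule has_derivative_subset) simp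
    show "((\<lambda>v. F (y t) v s) has_derivative Fz (y t) v s) (at v within ?V)"
      if "s \<in> ?J" "v \<in> ?V" for s v
      by (rule has_derivative_at_withinI[OF Fz[OF mem[OF cen(1) that(2,1)]]])
    have "continuous_on (?J \<times> ?V) (\<lambda>p. (\<lambda>(u, v, s). Fz u v s) (y t, snd p, fst p))"
      by (rule continuous_on_compose2[OF cont_z])
        (use mem[OF cen(1)] in \<open>auto intro!: continuous_intros simp del: mem_ball\<close>)
    then show "continuous (at (t, z t) within ?J \<times> ?V) (\<lambda>(s, v). Fz (y t) v s)"
      using cen by (simp add: continuous_on_eq_continuous_within case_prod_unfold)
  qed (use cen in auto)
  then have inner: "((\<lambda>p. F (y t) (snd p) (fst p)) has_derivative
      (\<lambda>p. fst p *\<^sub>R Ft + Fz (y t) (z t) t (snd p))) (at (t, z t) within ?J \<times> ?V)"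
    by (simp add: case_prod_unfold)
  have "((\<lambda>(p, u). F u (snd p) (fst p)) has_derivative
      (\<lambda>(dp, du). (fst dp *\<^sub>R Ft + Fz (y t) (z t) t (snd dp))
          + Fy (y t) (snd (t, z t)) (fst (t, z t)) du))
      (at ((t, z t), y t) within (?J \<times> ?V) \<times> ?U)"
  proof (rule has_derivative_partialsI[where f = "\<lambda>p u. F u (snd p) (fst p)"
        and fx = "\<lambda>dp. fst dp *\<^sub>R Ft + Fz (y t) (z t) t (snd dp)"
        and fy = "\<lambda>p u. Fy u (snd p) (fst p)"])
    show "((\<lambda>p. F (y t) (snd p) (fst p)) has_derivative
      (\<lambda>p. fst p *\<^sub>R Ft + Fz (y t) (z t) t (snd p))) (at (t, z t) within ?J \<times> ?V)" by (fact inner)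
    show "((\<lambda>u. F u (snd p) (fst p)) has_derivative Fy u (snd p) (fst p)) (at u within ?U)"
      if "p \<in> ?J \<times> ?V" "u \<in> ?U" for p u
      using that by (intro has_derivative_at_withinI[OF Fy[OF mem]]) auto
    have "continuous_on ((?J \<times> ?V) \<times> ?U) (\<lambda>q. (\<lambda>(u, v, s). Fy u v s) (snd q, snd (fst q), fst (fst q)))"
      by (rule continuous_on_compose2[OF cont_y])
        (use mem in \<open>auto intro!: continuous_intros simp del: mem_ball\<close>)
    then show "continuous (at ((t, z t), y t) within (?J \<times> ?V) \<times> ?U) (\<lambda>(p, u). Fy u (snd p) (fst p))"
      using cen by (simp add: continuous_on_eq_continuous_within case_prod_unfold)
  qed (use cen in auto)
  then have total: "((\<lambda>q. F (snd q) (snd (fst q)) (fst (fst q))) has_derivative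
      (\<lambda>q. fst (fst q) *\<^sub>R Ft + Fz (y t) (z t) t (snd (fst q)) + Fy (y t) (z t) t (snd q)))
      (at ((t, z t), y t) within (?J \<times> ?V) \<times> ?U)"
    by (simp add: case_prod_unfold)
  have "(y \<longlongrightarrow> y t) (at t within S)" "(z \<longlongrightarrow> z t) (at t within S)"
    using y z by (auto dest!: has_vector_derivative_continuous simp: continuous_within)
  then have "eventually (\<lambda>s. dist (y s) (y t) < r) (at t within S)"
    "eventually (\<lambda>s. dist (z s) (z t) < r) (at t within S)"
    using r(1) by (auto dest: tendstoD)
  then have "eventually (\<lambda>s. dist (y s) (y t) < r \<and> dist (z s) (z t) < r) (at t within S)"
    by eventually_elim simp
  then obtain \<rho> where \<rho>: "\<rho> > 0"
    "\<And>s. s \<in> S \<Longrightarrow> s \<noteq> t \<Longrightarrow> dist s t < \<rho> \<Longrightarrow> dist (y s) (y t) < r \<and> dist (z s) (z t) < r"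
    unfolding eventually_at by blast
  \<comment> \<open>Near \<open>t\<close> the curve stays inside the box on which the total
    derivative was taken.\<close>
  define K where "K = S \<inter> ball t (min r \<rho>)"
  have "s \<in> K \<Longrightarrow> y s \<in> ?U \<and> z s \<in> ?V" for s
    using \<rho>(2)[of s] r(1) by (cases "s = t") (auto simp: K_def dist_commute)
  then have im: "(\<lambda>s. ((s, z s), y s)) ` K \<subseteq> (?J \<times> ?V) \<times> ?U"
    by (auto simp: K_def)
  have KS: "K \<subseteq> S" by (simp add: K_def)
  have curve: "((\<lambda>s. ((s, z s), y s)) has_derivative (\<lambda>d. ((d, d *\<^sub>R z'), d *\<^sub>R y'))) (at t within K)"
    using has_derivative_subset[OF y[unfolded has_vector_derivative_def] KS]
      has_derivative_subset[OF z[unfolded has_vector_derivative_def] KS]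
    by (intro has_derivative_Pair has_derivative_ident)
  have "((\<lambda>s. F (y s) (z s) s) has_derivative
     (\<lambda>d. d *\<^sub>R Ft + Fz (y t) (z t) t (d *\<^sub>R z') + Fy (y t) (z t) t (d *\<^sub>R y'))) (at t within K)"
    using has_derivative_in_compose[OF curve has_derivative_subset[OF total im]] by simp
  moreover have "(\<lambda>d. d *\<^sub>R Ft + Fz (y t) (z t) t (d *\<^sub>R z') + Fy (y t) (z t) t (d *\<^sub>R y'))
     = (\<lambda>d. d *\<^sub>R (Fy (y t) (z t) t y' + Fz (y t) (z t) t z' + Ft))"
    by (simp add: blinfun.scaleR_right algebra_simps)
  ultimately have "((\<lambda>s. F (y s) (z s) s) has_vector_derivative
     Fy (y t) (z t) t y' + Fz (y t) (z t) t z' + Ft) (at t within K)"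
    by (simp add: has_vector_derivative_def)
  moreover have "at t within K = at t within S"
    using r(1) \<rho>(1) by (intro at_within_nhd[of _ "ball t (min r \<rho>)"]) (auto simp: K_def)
  ultimately show ?thesis by simp
qed

text \<open>The limit step in the exchange of derivatives below, where \<open>t\<close> may be an endpoint of the interval.\<close>
lemma norm_vector_derivative_le:
  assumes "a < b" "t \<in> {a..b}" "\<delta> > 0" and H: "(H has_vector_derivative H') (at t within {a..b})"
    and le: "\<And>s. s \<in> {a..b} \<Longrightarrow> \<bar>s - t\<bar> < \<delta> \<Longrightarrow> norm (H s - H t) \<le> C * \<bar>s - t\<bar>"
  shows "norm H' \<le> C"
proof (rule field_le_epsilon)
  fix e :: real assume "e > 0"
  obtain d where d: "d > 0" "\<And>s. s \<in> {a..b} \<Longrightarrow> \<bar>s - t\<bar> < d \<Longrightarrow>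
      norm (H s - H t - (s - t) *\<^sub>R H') \<le> e * \<bar>s - t\<bar>"
    using H \<open>e > 0\<close> unfolding has_vector_derivative_def has_derivative_within_alt real_norm_def by meson
  \<comment> \<open>A step to the side of \<open>t\<close> on which there is room: half the
    interval length fits on at least one side.\<close>
  define k where "k = min (min d \<delta>) (b - a) / 2"
  have k: "k > 0" "k < d" "k < \<delta>" "k \<le> (b - a) / 2" using d \<open>\<delta> > 0\<close> \<open>a < b\<close> by (auto simp: k_def)
  define s where "s = (if t + k \<le> b then t + k else t - k)"
  have s: "s \<in> {a..b}" "\<bar>s - t\<bar> = k"
    using k \<open>t \<in> {a..b}\<close> by (auto simp: s_def)
  have "k * norm H' = norm ((s - t) *\<^sub>R H')" using s by simp
  also have "\<dots> = norm ((H s - H t) - (H s - H t - (s - t) *\<^sub>R H'))" by simp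
  also have "\<dots> \<le> C * k + e * k"
    using norm_triangle_ineq4 le[OF s(1)] d(2)[OF s(1)] s(2) k by (smt (verit))
  finally have "k * norm H' \<le> k * (C + e)" by (simp add: algebra_simps)
  then show "norm H' \<le> C + e" using k(1) by simp
qed

text \<open>Schwarz's theorem in the asymmetric form in which existence of the second mixed derivative is part
  of the conclusion: if \<open>G\<^sub>y\<close> has a continuous time derivative \<open>G\<^sub>y\<^sub>t\<close>, then \<open>G\<^sub>t\<close> is
  differentiable in the space variable with derivative \<open>G\<^sub>y\<^sub>t\<close>. The mean value theorem in time
  compares \<open>G\<^sub>y(w,t) - G\<^sub>y(w,\<tau>)\<close> with \<open>(t - \<tau>) G\<^sub>y\<^sub>t(u\<^sub>0,\<tau>)\<close>; the mean value theorem in space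
  then bounds the second difference of \<open>G\<close>, and dividing by \<open>t - \<tau>\<close> gives the claim as
  \<open>t \<rightarrow> \<tau>\<close>.\<close>
lemma mixed_partial_exchange:
  fixes G :: "'a::real_normed_vector \<Rightarrow> real \<Rightarrow> 'c::real_normed_vector"
    and Gy Gyt :: "'a \<Rightarrow> real \<Rightarrow> 'a \<Rightarrow>\<^sub>L 'c"
  assumes r: "r > 0" and ab: "a < b" "\<tau> \<in> {a..b}"
    and Gy: "\<And>u s. u \<in> ball u0 r \<Longrightarrow> s \<in> {a..b} \<inter> ball \<tau> r \<Longrightarrow> ((\<lambda>u'. G u' s) has_derivative Gy u s) (at u)"
    and Gt: "\<And>u. u \<in> ball u0 r \<Longrightarrow> (G u has_vector_derivative Gt u) (at \<tau> within {a..b})"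
    and Gyt: "\<And>u s. u \<in> ball u0 r \<Longrightarrow> s \<in> {a..b} \<inter> ball \<tau> r \<Longrightarrow>
        (Gy u has_vector_derivative Gyt u s) (at s within {a..b})"
    and cont: "continuous_on (ball u0 r \<times> ({a..b} \<inter> ball \<tau> r)) (\<lambda>(u, s). Gyt u s)"
  shows "(Gt has_derivative Gyt u0 \<tau>) (at u0)"
  unfolding has_derivative_at_alt
proof (intro conjI allI impI)
  show "bounded_linear (Gyt u0 \<tau>)" by (rule blinfun.bounded_linear_right)
next
  fix e :: real assume "e > 0"
  have "(u0, \<tau>) \<in> ball u0 r \<times> ({a..b} \<inter> ball \<tau> r)" using r ab by simp
  from cont[unfolded continuous_on_iff, rule_format, OF this \<open>e > 0\<close>]
  obtain d where d: "d > 0" "\<And>u s. u \<in> ball u0 r \<Longrightarrow> s \<in> {a..b} \<inter> ball \<tau> r \<Longrightarrow>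
      dist (u, s) (u0, \<tau>) < d \<Longrightarrow> norm (Gyt u s - Gyt u0 \<tau>) < e"
    by (auto simp: dist_norm)
  define \<delta> where "\<delta> = min r (d / 2)"
  have \<delta>: "\<delta> > 0" "\<delta> \<le> r" using d(1) r by (auto simp: \<delta>_def)
  let ?J = "{a..b} \<inter> ball \<tau> \<delta>"
  have sub: "u \<in> ball u0 r" "s \<in> {a..b} \<inter> ball \<tau> r" if "u \<in> ball u0 \<delta>" "s \<in> ?J" for u s
    using that \<delta>(2) by auto
  have close: "norm (Gyt u s - Gyt u0 \<tau>) \<le> e" if "u \<in> ball u0 \<delta>" "s \<in> ?J" for u s
  proof -
    have "dist (u, s) (u0, \<tau>) \<le> dist u u0 + dist s \<tau>"
      unfolding dist_Pair_Pair by (rule order_trans[OF sqrt_sum_squares_le_sum]) auto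
    also have "\<dots> < d" using that by (auto simp: \<delta>_def dist_commute)
    finally show ?thesis using d(2)[OF sub[OF that]] by simp
  qed
  have \<tau>J: "\<tau> \<in> ?J" using ab \<delta> by simp
  show "\<exists>d>0. \<forall>u. norm (u - u0) < d \<longrightarrow> norm (Gt u - Gt u0 - Gyt u0 \<tau> (u - u0)) \<le> e * norm (u - u0)"
  proof (intro exI[of _ \<delta>] conjI allI impI \<delta>(1))
    fix u assume "norm (u - u0) < \<delta>"
    then have u: "u \<in> ball u0 \<delta>" by (simp add: dist_norm norm_minus_commute)
    have u0: "u0 \<in> ball u0 \<delta>" using \<delta> by simp
    define H where "H s = G u s - G u0 s - s *\<^sub>R Gyt u0 \<tau> (u - u0)" for s
    have "(H has_vector_derivative Gt u - Gt u0 - Gyt u0 \<tau> (u - u0)) (at \<tau> within {a..b})"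
      unfolding H_def[abs_def] using Gt[OF sub(1)[OF u \<tau>J]] Gt[OF sub(1)[OF u0 \<tau>J]]
      by (auto intro!: derivative_eq_intros)
    then show "norm (Gt u - Gt u0 - Gyt u0 \<tau> (u - u0)) \<le> e * norm (u - u0)"
    proof (rule norm_vector_derivative_le[OF ab \<delta>(1)])
      fix t assume t: "t \<in> {a..b}" "\<bar>t - \<tau>\<bar> < \<delta>"
      then have tJ: "t \<in> ?J" by (simp add: dist_real_def)
      have slope: "norm (Gy w t - Gy w \<tau> - (t - \<tau>) *\<^sub>R Gyt u0 \<tau>) \<le> e * \<bar>t - \<tau>\<bar>" if w: "w \<in> ball u0 \<delta>" for w
      proof -
        have "norm ((Gy w t - t *\<^sub>R Gyt u0 \<tau>) - (Gy w \<tau> - \<tau> *\<^sub>R Gyt u0 \<tau>)) \<le> e * norm (t - \<tau>)"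
        proof (rule differentiable_bound[of ?J _ "\<lambda>s d. d *\<^sub>R (Gyt w s - Gyt u0 \<tau>)"])
          fix s assume s: "s \<in> ?J"
          have "((\<lambda>s. Gy w s - s *\<^sub>R Gyt u0 \<tau>) has_vector_derivative Gyt w s - Gyt u0 \<tau>) (at s within ?J)"
            using has_vector_derivative_within_subset[OF Gyt[OF sub[OF w s]], of ?J]
            by (auto intro!: derivative_eq_intros)
          then show "((\<lambda>s. Gy w s - s *\<^sub>R Gyt u0 \<tau>) has_derivative (\<lambda>d. d *\<^sub>R (Gyt w s - Gyt u0 \<tau>))) (at s within ?J)"
            by (simp add: has_vector_derivative_def)
          show "onorm (\<lambda>d. d *\<^sub>R (Gyt w s - Gyt u0 \<tau>)) \<le> e"
            by (rule onorm_bound) (use close[OF w s] \<open>e > 0\<close> in \<open>auto simp: mult.commute[of e] intro!: mult_left_mono\<close>)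
        qed (use tJ \<tau>J in \<open>auto intro: convex_Int\<close>)
        then show ?thesis by (simp add: algebra_simps)
      qed
      have "norm ((G u t - G u \<tau> - (t - \<tau>) *\<^sub>R Gyt u0 \<tau> u) - (G u0 t - G u0 \<tau> - (t - \<tau>) *\<^sub>R Gyt u0 \<tau> u0))
          \<le> (e * \<bar>t - \<tau>\<bar>) * norm (u - u0)"
      proof (rule differentiable_bound[of "ball u0 \<delta>" _ "\<lambda>w. blinfun_apply (Gy w t - Gy w \<tau> - (t - \<tau>) *\<^sub>R Gyt u0 \<tau>)"])
        fix w assume w: "w \<in> ball u0 \<delta>"
        show "((\<lambda>w. G w t - G w \<tau> - (t - \<tau>) *\<^sub>R Gyt u0 \<tau> w) has_derivative
            Gy w t - Gy w \<tau> - (t - \<tau>) *\<^sub>R Gyt u0 \<tau>) (at w within ball u0 \<delta>)"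
          using has_derivative_at_withinI[OF Gy[OF sub[OF w tJ]]] has_derivative_at_withinI[OF Gy[OF sub[OF w \<tau>J]]]
          by (auto intro!: derivative_eq_intros simp: blinfun.bilinear_simps fun_eq_iff)
        show "onorm (Gy w t - Gy w \<tau> - (t - \<tau>) *\<^sub>R Gyt u0 \<tau>) \<le> e * \<bar>t - \<tau>\<bar>"
          using slope[OF w] by (simp add: norm_blinfun.rep_eq)
      qed (use u u0 in auto)
      then show "norm (H t - H \<tau>) \<le> e * norm (u - u0) * \<bar>t - \<tau>\<bar>"
        by (simp add: H_def blinfun.bilinear_simps algebra_simps)
    qed
  qed
qed

section \<open>Jacobians along curves\<close>

text \<open>Continuity of a matrix-valued function becomes continuity in operator norm, which is the form that
  the chain rule above asks for.\<close>
definition mat_blinfun :: "real^'n^'m \<Rightarrow> (real^'n::finite) \<Rightarrow>\<^sub>L (real^'m::finite)" where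
  "mat_blinfun A = Blinfun ((*v) A)"

lemma mat_blinfun_apply [simp]: "blinfun_apply (mat_blinfun A) x = A *v x"
  by (simp add: mat_blinfun_def bounded_linear_Blinfun_apply)

lemma bounded_linear_mat_blinfun: "bounded_linear mat_blinfun"
  unfolding linear_conv_bounded_linear[symmetric]
  by (rule linearI)
    (auto intro!: blinfun_eqI simp: blinfun.bilinear_simps matrix_vector_mult_add_rdistrib scaleR_matrix_vector_assoc)

lemma C1_y_onD:
  assumes "C1_y_on D F"
  shows "(u, v, t) \<in> D \<Longrightarrow> ((\<lambda>u'. F u' v t) has_derivative mat_blinfun (D_y F u v t)) (at u)"
    and "continuous_on D (\<lambda>(u, v, t). mat_blinfun (D_y F u v t))"
proof -
  show "((\<lambda>u'. F u' v t) has_derivative mat_blinfun (D_y F u v t)) (at u)" if "(u, v, t) \<in> D"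
  proof -
    have "(\<lambda>u'. F u' v t) differentiable (at u)" using assms that by (auto simp: C1_y_on_def)
    then show ?thesis unfolding jacobian_works D_y_def by (simp add: mat_blinfun_apply[abs_def])
  qed
  show "continuous_on D (\<lambda>(u, v, t). mat_blinfun (D_y F u v t))"
    using bounded_linear.continuous_on[OF bounded_linear_mat_blinfun, of D "\<lambda>(u, v, t). D_y F u v t"] assms
    by (simp add: C1_y_on_def case_prod_unfold)
qed

lemma C1_z_onD:
  assumes "C1_z_on D F"
  shows "(u, v, t) \<in> D \<Longrightarrow> ((\<lambda>v'. F u v' t) has_derivative mat_blinfun (D_z F u v t)) (at v)"
    and "continuous_on D (\<lambda>(u, v, t). mat_blinfun (D_z F u v t))"
proof -
  show "((\<lambda>v'. F u v' t) has_derivative mat_blinfun (D_z F u v t)) (at v)" if "(u, v, t) \<in> D"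
  proof -
    have "(\<lambda>v'. F u v' t) differentiable (at v)" using assms that by (auto simp: C1_z_on_def)
    then show ?thesis unfolding jacobian_works D_z_def by (simp add: mat_blinfun_apply[abs_def])
  qed
  show "continuous_on D (\<lambda>(u, v, t). mat_blinfun (D_z F u v t))"
    using bounded_linear.continuous_on[OF bounded_linear_mat_blinfun, of D "\<lambda>(u, v, t). D_z F u v t"] assms
    by (simp add: C1_z_on_def case_prod_unfold)
qed

lemma C1_t_onD:
  assumes "C1_t_on T D F" "(u, v, t) \<in> D"
  shows "(F u v has_vector_derivative D_t T F u v t) (at t within {0..T})"
proof -
  have "(\<lambda>t'. F u v t') differentiable (at t within {0..T})" using assms by (auto simp: C1_t_on_def)
  then show ?thesis unfolding vector_derivative_works D_t_def by simp
qed

lemma C1_t_on_row: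
  fixes F :: "('n::finite, 'm::finite, real^'k::finite^'l::finite) fld"
  assumes "C1_t_on T D F" "(u, v, t) \<in> D"
  shows "((\<lambda>s. F u v s $ i) has_vector_derivative D_t T F u v t $ i) (at t within {0..T})"
  using bounded_linear.has_vector_derivative[OF bounded_linear_vec_nth C1_t_onD[OF assms]] .

lemma D_y_eqI:
  assumes "((\<lambda>u'. F u' v t) has_derivative (*v) A) (at u)"
  shows "D_y F u v t = A"
  using frechet_derivative_at[OF assms, symmetric] by (simp add: D_y_def jacobian_def matrix_of_matrix_vector_mul)

text \<open>In the index-2 case \<open>g\<close> does not depend on \<open>z\<close>, and this is inherited by \<open>g\<^sub>y\<close> and \<open>g\<^sub>t\<close>.\<close>
lemma indep_z:
  assumes "\<And>u v v' t. F u v t = F u v' t"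
  shows C1_z_on_indep_z: "C1_z_on D F" and D_z_indep_z: "D_z F u v t = 0"
proof -
  have eq: "(\<lambda>v'. F u v' t) = (\<lambda>_. F u 0 t)" for u t using assms by blast
  have D0: "D_z F u v t = 0" for u v t
    unfolding D_z_def jacobian_def eq frechet_derivative_const by (simp add: matrix_def vec_eq_iff)
  then show "D_z F u v t = 0" .
  show "C1_z_on D F" unfolding C1_z_on_def by (auto simp: eq D0 case_prod_unfold)
qed

lemma has_vector_derivative_along_curve:
  fixes F :: "('n::finite, 'm::finite, real^'k::finite) fld"
  assumes "openin (top_of_set (UNIV \<times> UNIV \<times> S)) D" "t \<in> S" "(y t, z t, t) \<in> D"
    and Fy: "C1_y_on D F" and Fz: "C1_z_on D F"
    and "(F (y t) (z t) has_vector_derivative Ft) (at t within S)"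
    and "(y has_vector_derivative y') (at t within S)"
    and "(z has_vector_derivative z') (at t within S)"
  shows "((\<lambda>s. F (y s) (z s) s) has_vector_derivative
     D_y F (y t) (z t) t *v y' + D_z F (y t) (z t) t *v z' + Ft) (at t within S)"
  using has_vector_derivative_continuous_partials[OF assms(1-3) C1_y_onD(1)[OF Fy] C1_z_onD(1)[OF Fz]
    C1_y_onD(2)[OF Fy] C1_z_onD(2)[OF Fz] assms(6-8)] by simp

text \<open>The regularity assumptions provide \<open>g\<^sub>y\<^sub>t\<close> as the time derivative of \<open>g\<^sub>y\<close> only, whereas
  differentiating the hidden constraint \<open>g\<^sub>y f + g\<^sub>t = 0\<close> needs the \<open>y\<close>-derivative of \<open>g\<^sub>t\<close>.
  That both agree is also the origin of the factor 2 in \<open>h\<close>.\<close>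
lemma D_y_D_t_exchange:
  fixes F :: "('n::finite, 'm::finite, real^'k::finite) fld"
  assumes T: "T > 0" and D: "openin (top_of_set (UNIV \<times> UNIV \<times> {0..T})) D"
    and Fy: "C1_y_on D F" and Ft: "C1_t_on T D F" and Fyt: "C1_t_on T D (D_y F)"
  shows "C1_y_on D (D_t T F)" and "(u, v, t) \<in> D \<Longrightarrow> D_y (D_t T F) u v t = D_t T (D_y F) u v t"
proof -
  have main: "((\<lambda>u'. D_t T F u' v t) has_derivative mat_blinfun (D_t T (D_y F) u v t)) (at u)"
    if uvt: "(u, v, t) \<in> D" for u v t
  proof -
    obtain r where r: "r > 0" "ball u r \<times> ball v r \<times> ({0..T} \<inter> ball t r) \<subseteq> D"
      using openin_box_within_strip[OF D uvt] by blast
    have t: "t \<in> {0..T}" using openin_imp_subset[OF D] uvt by auto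
    have mem: "(w, v, s) \<in> D" if "w \<in> ball u r" "s \<in> {0..T} \<inter> ball t r" for w s
      using r that by auto
    have "continuous_on D (\<lambda>p. mat_blinfun (case p of (u, v, t) \<Rightarrow> D_t T (D_y F) u v t))"
      by (rule bounded_linear.continuous_on[OF bounded_linear_mat_blinfun])
        (use Fyt in \<open>simp add: C1_t_on_def\<close>)
    then have "continuous_on (ball u r \<times> ({0..T} \<inter> ball t r))
        (\<lambda>p. mat_blinfun (case (fst p, v, snd p) of (u, v, t) \<Rightarrow> D_t T (D_y F) u v t))"
      by (rule continuous_on_compose2) (use mem in \<open>auto intro!: continuous_intros simp del: mem_ball\<close>)
    then have cont: "continuous_on (ball u r \<times> ({0..T} \<inter> ball t r)) (\<lambda>(w, s). mat_blinfun (D_t T (D_y F) w v s))"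
      by (simp add: case_prod_unfold)
    show ?thesis
    proof (rule mixed_partial_exchange[OF r(1) T t _ _ _ cont])
      show "((\<lambda>u'. F u' v s) has_derivative mat_blinfun (D_y F w v s)) (at w)"
        if "w \<in> ball u r" "s \<in> {0..T} \<inter> ball t r" for w s
        by (rule C1_y_onD(1)[OF Fy mem[OF that]])
      show "(F w v has_vector_derivative D_t T F w v t) (at t within {0..T})" if "w \<in> ball u r" for w
        using C1_t_onD[OF Ft mem[OF that]] t r(1) by simp
      show "((\<lambda>s. mat_blinfun (D_y F w v s)) has_vector_derivative mat_blinfun (D_t T (D_y F) w v s)) (at s within {0..T})"
        if "w \<in> ball u r" "s \<in> {0..T} \<inter> ball t r" for w s
        by (rule bounded_linear.has_vector_derivative[OF bounded_linear_mat_blinfun C1_t_onD[OF Fyt mem[OF that]]])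
    qed
  qed
  have eq: "D_y (D_t T F) u v t = D_t T (D_y F) u v t" if "(u, v, t) \<in> D" for u v t
    by (rule D_y_eqI) (use main[OF that] in \<open>simp add: mat_blinfun_apply[abs_def]\<close>)
  then show "(u, v, t) \<in> D \<Longrightarrow> D_y (D_t T F) u v t = D_t T (D_y F) u v t" .
  have "continuous_on D (\<lambda>p. case p of (u, v, t) \<Rightarrow> D_t T (D_y F) u v t)"
    using Fyt by (simp add: C1_t_on_def)
  then have "continuous_on D (\<lambda>(u, v, t). D_y (D_t T F) u v t)"
    by (rule continuous_on_eq) (auto simp: eq)
  then show "C1_y_on D (D_t T F)"
    using main unfolding C1_y_on_def differentiable_def by blast
qed

text \<open>The fundamental theorem of calculus along the segment from \<open>(Y,Z)\<close> to \<open>(y,z)\<close>, with time frozen.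
  This identity is exact, so the error satisfies a linear equation without remainder.\<close>
lemma mean_value_mean_jac:
  fixes F :: "('n::finite, 'm::finite, real^'k::finite) fld"
  assumes D: "openin (top_of_set (UNIV \<times> UNIV \<times> S)) D"
    and Fy: "C1_y_on D F" and Fz: "C1_z_on D F"
    and seg: "\<forall>s\<in>{0..1}. (seg_pt s (y t) (Y t), seg_pt s (z t) (Z t), t) \<in> D"
  shows "F (y t) (z t) t - F (Y t) (Z t) t
     = mean_jac (D_y F) y z Y Z t *v (y t - Y t) + mean_jac (D_z F) y z Y Z t *v (z t - Z t)"
proof -
  \<comment> \<open>Frozen time turns the segment parameter into a dummy time variable, so that
    the chain rule along curves applies.\<close>
  define G where "G u v s = F u v t" for u v and s :: real
  define D1 where "D1 = {(u, v, s). s \<in> {0..1::real} \<and> (u, v, t) \<in> D}"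
  let ?u = "\<lambda>s. seg_pt s (y t) (Y t)" and ?v = "\<lambda>s. seg_pt s (z t) (Z t)"
  have "t \<in> S" using openin_imp_subset[OF D] seg by fastforce
  obtain W where W: "open W" "D = (UNIV \<times> UNIV \<times> S) \<inter> W"
    using D by (auto simp: openin_open)
  have "open ((\<lambda>(u, v, s::real). (u, v, t)) -` W)"
    by (rule open_vimage[OF W(1)]) (auto simp: case_prod_unfold intro!: continuous_intros)
  moreover have "D1 = (UNIV \<times> UNIV \<times> {0..1}) \<inter> ((\<lambda>(u, v, s::real). (u, v, t)) -` W)"
    using W(2) \<open>t \<in> S\<close> by (auto simp: D1_def)
  ultimately have D1: "openin (top_of_set (UNIV \<times> UNIV \<times> {0..1})) D1"
    by (auto simp: openin_open)
  have jac: "D_y G u v s = D_y F u v t" "D_z G u v s = D_z F u v t" for u v s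
    by (simp_all add: D_y_def D_z_def G_def)
  have restr: "continuous_on D1 (\<lambda>(u, v, s). J u v t)" if "continuous_on D (\<lambda>(u, v, s). J u v s)"
    for J :: "('n, 'm, 'c::topological_space) fld"
  proof -
    have "continuous_on D1 (\<lambda>p. (\<lambda>(u, v, s). J u v s) (fst p, fst (snd p), t))"
      by (rule continuous_on_compose2[OF that]) (auto simp: D1_def intro!: continuous_intros)
    then show ?thesis by (simp add: case_prod_unfold)
  qed
  have G1: "C1_y_on D1 G" "C1_z_on D1 G"
    using Fy Fz restr unfolding C1_y_on_def C1_z_on_def jac by (auto simp: D1_def G_def)
  have in1: "(?u s, ?v s, s) \<in> D1" if "s \<in> {0..1}" for s using seg that by (auto simp: D1_def)
  have der: "((\<lambda>s. G (?u s) (?v s) s) has_vector_derivative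
      D_y F (?u s) (?v s) t *v (y t - Y t) + D_z F (?u s) (?v s) t *v (z t - Z t)) (at s within {0..1})"
    if s: "s \<in> {0..1}" for s
  proof -
    have "(?u has_vector_derivative y t - Y t) (at s within {0..1})"
      "(?v has_vector_derivative z t - Z t) (at s within {0..1})"
      unfolding seg_pt_def by (auto intro!: derivative_eq_intros)
    moreover have "(G (?u s) (?v s) has_vector_derivative 0) (at s within {0..1})"
      by (simp add: G_def[abs_def])
    ultimately show ?thesis
      using has_vector_derivative_along_curve[where y = ?u and z = ?v, OF D1 s in1[OF s] G1, of 0]
      by (simp add: jac)
  qed
  have "((\<lambda>s. D_y F (?u s) (?v s) t *v (y t - Y t) + D_z F (?u s) (?v s) t *v (z t - Z t))
      has_integral G (?u 1) (?v 1) 1 - G (?u 0) (?v 0) 0) {0..1}"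
    by (rule fundamental_theorem_of_calculus[OF _ der]) auto
  then have I: "((\<lambda>s. D_y F (?u s) (?v s) t *v (y t - Y t) + D_z F (?u s) (?v s) t *v (z t - Z t))
      has_integral F (y t) (z t) t - F (Y t) (Z t) t) {0..1}"
    by (simp add: G_def seg_pt_def)
  have J: "((\<lambda>s. J (?u s) (?v s) t *v d) has_integral mean_jac J y z Y Z t *v d) {0..1}"
    if "continuous_on D (\<lambda>(u, v, s). J u v s)"
    for J :: "('n, 'm, real^'l::finite^'k) fld" and d
  proof -
    have "continuous_on {0..1} (\<lambda>s. (\<lambda>(u, v, s). J u v s) (?u s, ?v s, t))"
      by (rule continuous_on_compose2[OF that]) (use seg in \<open>auto simp: seg_pt_def intro!: continuous_intros\<close>)
    then have mean: "((\<lambda>s. J (?u s) (?v s) t) has_integral mean_jac J y z Y Z t) {0..1}"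
      unfolding mean_jac_def by (intro integrable_integral integrable_continuous_real) simp
    have apply_d: "bounded_linear (\<lambda>A :: real^'l^'k. A *v d)"
      unfolding linear_conv_bounded_linear[symmetric]
      by (rule linearI) (simp_all add: matrix_vector_mult_add_rdistrib scaleR_matrix_vector_assoc)
    show ?thesis using has_integral_linear[OF mean apply_d] by (simp add: o_def)
  qed
  have "((\<lambda>s. D_y F (?u s) (?v s) t *v (y t - Y t) + D_z F (?u s) (?v s) t *v (z t - Z t)) has_integral
     mean_jac (D_y F) y z Y Z t *v (y t - Y t) + mean_jac (D_z F) y z Y Z t *v (z t - Z t)) {0..1}"
    using Fy Fz by (intro has_integral_add J) (simp_all add: C1_y_on_def C1_z_on_def)
  with I show ?thesis by (rule has_integral_unique)
qed

section \<open>The index-reduced differential equation\<close>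

lemma solve_invertible:
  fixes A :: "real^'m^'m::finite"
  assumes "invertible A" "A *v x + b = 0"
  shows "x = - (matrix_inv A *v b)"
proof -
  have "A *v x = - b" using assms(2) by (simp add: eq_neg_iff_add_eq_0)
  then have "matrix_inv A *v (A *v x) = matrix_inv A *v (0 - b)" by simp
  moreover have "matrix_inv A ** A = mat 1"
    using someI_ex[OF assms(1)[unfolded invertible_def]] by (simp add: matrix_inv_def)
  ultimately show ?thesis
    by (simp add: matrix_vector_mul_assoc matrix_vector_mult_diff_distrib
        del: diff_0)
qed

text \<open>Differentiate the constraint along the solution until \<open>z'\<close> appears with an invertible coefficient.
  For index 1 the first derivative \<open>g\<^sub>y f + g\<^sub>z z' + g\<^sub>t = 0\<close> already does. For index 2 it is the
  hidden constraint \<open>g\<^sub>y f + g\<^sub>t = 0\<close>, and its derivative contains \<open>g\<^sub>y f\<^sub>z z'\<close>.\<close>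
lemma index_reduced_ode:
  fixes f :: "('n::finite, 'm::finite, real^'n) fld" and g :: "('n, 'm, real^'m) fld"
  assumes T: "T > 0" and D: "openin (top_of_set (UNIV \<times> UNIV \<times> {0..T})) D"
    and index: "semi_explicit_index1 D g \<or> hessenberg_index2 D f g"
    and smooth: "smooth_data T D f g" and sol: "dae_solution T f g y z"
    and inD: "\<And>t. t \<in> {0..T} \<Longrightarrow> (y t, z t, t) \<in> D" and t: "t \<in> {0..T}"
  shows "(z has_vector_derivative index_reduced_rhs T D f g (y t) (z t) t) (at t within {0..T})"
proof -
  define z' where "z' t = vector_derivative z (at t within {0..T})" for t
  have y': "(y has_vector_derivative f (y t) (z t) t) (at t within {0..T})" 
    and z': "(z has_vector_derivative z' t) (at t within {0..T})"
    and g0: "g (y t) (z t) t = 0" if "t \<in> {0..T}" for t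
    using sol that by (auto simp: dae_solution_def z'_def differentiable_on_def vector_derivative_works)
  have zero: "c = 0" if "(F has_vector_derivative c) (at t within {0..T})" "\<And>s. s \<in> {0..T} \<Longrightarrow> F s = 0"
    "t \<in> {0..T}" for F :: "real \<Rightarrow> 'c::euclidean_space" and c t
  proof (rule vector_derivative_unique_within_closed_interval[OF T])
    show "(F has_vector_derivative 0) (at t within cbox 0 T)"
      by (rule has_vector_derivative_transform[of _ _ _ "\<lambda>_. 0"]) (use that in auto)
  qed (use that in auto)
  have gC: "C1_y_on D g" "C1_z_on D g" "C1_t_on T D g" and fC: "C1_y_on D f" "C1_z_on D f"
    using smooth by (auto simp: smooth_data_def)
  have g1: "D_y g (y t) (z t) t *v f (y t) (z t) t + D_z g (y t) (z t) t *v z' t + D_t T g (y t) (z t) t = 0"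
    if "t \<in> {0..T}" for t
    by (rule zero[OF has_vector_derivative_along_curve[OF D that inD[OF that] gC(1,2)
        C1_t_onD[OF gC(3) inD[OF that]] y'[OF that] z'[OF that]] g0 that])
  have "z' t = index_reduced_rhs T D f g (y t) (z t) t"
  proof (cases "semi_explicit_index1 D g")
    case True
    then have "invertible (D_z g (y t) (z t) t)" using inD[OF t] by (auto simp: semi_explicit_index1_def)
    then have "z' t = - (matrix_inv (D_z g (y t) (z t) t) *v
        (D_y g (y t) (z t) t *v f (y t) (z t) t + D_t T g (y t) (z t) t))"
      by (rule solve_invertible) (use g1[OF t] in \<open>simp add: algebra_simps\<close>)
    then show ?thesis using True by (simp add: index_reduced_rhs_def)
  next
    case False
    then have h2: "hessenberg_index2 D f g" using index by simp
    then have gv: "\<And>u v v' t. g u v t = g u v' t" and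
      inv: "invertible (D_y g (y t) (z t) t ** D_z f (y t) (z t) t)"
      using inD[OF t] by (auto simp: hessenberg_index2_def)
    have ft: "C1_t_on T D f" and gyy: "\<And>i. C1_y_on D (\<lambda>u v t. D_y g u v t $ i)"
      and gyt: "C1_t_on T D (D_y g)" and gtt: "C1_t_on T D (D_t T g)"
      using smooth h2 by (auto simp: smooth_data_def)
    have gfun: "g u v = g u v'" for u v v' by (rule ext) (rule gv)
    have gyv: "D_y g u v t = D_y g u v' t" and gtv: "D_t T g u v t = D_t T g u v' t" for u v v' t
      using gv[of _ v _ v'] gfun[of u v v'] by (simp_all add: D_y_def D_t_def)
    have hidden: "D_y g (y t) (z t) t *v f (y t) (z t) t + D_t T g (y t) (z t) t = 0" if "t \<in> {0..T}" for t
      using g1[OF that] D_z_indep_z[of g, OF gv] by simp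
    let ?f = "f (y t) (z t) t" and ?gyt = "D_t T (D_y g) (y t) (z t) t" and ?gy = "D_y g (y t) (z t) t"
    define f' where "f' = D_y f (y t) (z t) t *v ?f + D_z f (y t) (z t) t *v z' t + D_t T f (y t) (z t) t"
    have df: "((\<lambda>s. f (y s) (z s) s) has_vector_derivative f') (at t within {0..T})"
      unfolding f'_def by (rule has_vector_derivative_along_curve[OF D t inD[OF t] fC
        C1_t_onD[OF ft inD[OF t]] y'[OF t] z'[OF t]])
    have dgt: "((\<lambda>s. D_t T g (y s) (z s) s) has_vector_derivative ?gyt *v ?f + D_t T (D_t T g) (y t) (z t) t)
        (at t within {0..T})"
      using has_vector_derivative_along_curve[OF D t inD[OF t] D_y_D_t_exchange(1)[OF T D gC(1,3) gyt]
          C1_z_on_indep_z[OF gtv] C1_t_onD[OF gtt inD[OF t]] y'[OF t] z'[OF t]]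
      by (simp add: D_y_D_t_exchange(2)[OF T D gC(1,3) gyt inD[OF t]] D_z_indep_z[OF gtv])
    \<comment> \<open>The derivative of the hidden constraint, component by component, because the
      second derivatives of \<open>g\<close> are available row by row of
      \<open>g\<^sub>y\<close>.\<close>
    have row: "(quad_yy f g (y t) (z t) t + ?gyt *v ?f + ?gy *v f'
         + (?gyt *v ?f + D_t T (D_t T g) (y t) (z t) t)) $ i = 0" for i
    proof -
      let ?gyy = "D_y (\<lambda>u v t. D_y g u v t $ i) (y t) (z t) t"
      have gyiv: "D_y g u v t $ i = D_y g u v' t $ i" for u v v' t using gyv by metis
      have dgy: "((\<lambda>s. D_y g (y s) (z s) s $ i) has_vector_derivative ?gyy *v ?f + ?gyt $ i) (at t within {0..T})"
        using has_vector_derivative_along_curve[OF D t inD[OF t] gyy[of i] C1_z_on_indep_z[OF gyiv]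
           C1_t_on_row[OF gyt inD[OF t]] y'[OF t] z'[OF t]]
        by (simp add: D_z_indep_z[OF gyiv])
      have "((\<lambda>s. (D_y g (y s) (z s) s $ i) \<bullet> f (y s) (z s) s + D_t T g (y s) (z s) s $ i) has_vector_derivative
           (?gy $ i) \<bullet> f' + (?gyy *v ?f + ?gyt $ i) \<bullet> ?f + (?gyt *v ?f + D_t T (D_t T g) (y t) (z t) t) $ i)
           (at t within {0..T})"
        by (intro has_vector_derivative_add bounded_bilinear.has_vector_derivative[OF bounded_bilinear_inner]
            dgy df bounded_linear.has_vector_derivative[OF bounded_linear_vec_nth dgt])
      then have "(?gy $ i) \<bullet> f' + (?gyy *v ?f + ?gyt $ i) \<bullet> ?f + (?gyt *v ?f + D_t T (D_t T g) (y t) (z t) t) $ i = 0"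
      proof (rule zero[OF _ _ t])
        fix s assume "s \<in> {0..T}"
        from hidden[OF this] show "(D_y g (y s) (z s) s $ i) \<bullet> f (y s) (z s) s + D_t T g (y s) (z s) s $ i = 0"
          by (simp add: vec_eq_iff matrix_vector_mul_component)
      qed
      moreover have "(?gyy *v ?f) \<bullet> ?f = quad_yy f g (y t) (z t) t $ i"
        unfolding quad_yy_def inner_vec_def matrix_vector_mult_def
        by (simp add: sum_distrib_right) (rule sum.swap)
      ultimately show ?thesis
        by (simp add: matrix_vector_mul_component inner_add_left)
    qed
    then have "quad_yy f g (y t) (z t) t + ?gyt *v ?f + ?gy *v f' + (?gyt *v ?f + D_t T (D_t T g) (y t) (z t) t) = 0"
      by (simp add: vec_eq_iff)
    then have eq: "(?gy ** D_z f (y t) (z t) t) *v z' t + (quad_yy f g (y t) (z t) t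
        + ?gy *v (D_y f (y t) (z t) t *v ?f) + 2 *\<^sub>R (?gyt *v ?f) + ?gy *v D_t T f (y t) (z t) t
        + D_t T (D_t T g) (y t) (z t) t) = 0"
      by (simp add: f'_def matrix_vector_right_distrib matrix_vector_mul_assoc[symmetric] scaleR_2 algebra_simps)
    show ?thesis
      using solve_invertible[OF inv eq] False by (simp add: index_reduced_rhs_def)
  qed
  then show ?thesis using z'[OF t] by simp
qed

section \<open>Piecewise linear interpolants\<close>

lemma grid_cell:
  fixes d :: real
  assumes "0 \<le> t" "t \<le> real n * d" "n > 0"
  shows "\<exists>k<n. t \<in> {real k * d .. real (Suc k) * d}"
  using assms
proof (induction n)
  case (Suc n)
  show ?case
  proof (cases "n > 0 \<and> t \<le> real n * d")
    case True
    then show ?thesis using Suc by (metis less_SucI)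
  next
    case False
    then show ?thesis using Suc.prems by (intro exI[of _ n]) auto
  qed
qed simp

text \<open>Continuity across the nodes is implicit in the interpolation property: neighbouring cells both
  contain their common node and prescribe a value there.\<close>
lemma pw_linear_lipschitz:
  fixes X :: "real \<Rightarrow> 'a::real_normed_vector"
  assumes T: "T > 0" and N: "N > 0" and X: "pw_linear_interpolant T N Xk X"
  shows "\<exists>L. L-lipschitz_on {0..T} X"
proof -
  define d where "d = T / real N"
  have "d > 0" using T N by (simp add: d_def)
  have piece: "\<exists>L. L-lipschitz_on {real k * d .. real (Suc k) * d} X" if "k < N" for k
  proof -
    let ?c = "(1 / d) *\<^sub>R (Xk (Suc k) - Xk k)"
    have "(norm ?c)-lipschitz_on {real k * d .. real (Suc k) * d} X"
    proof (rule lipschitz_onI)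
      fix s t assume st: "s \<in> {real k * d .. real (Suc k) * d}" "t \<in> {real k * d .. real (Suc k) * d}"
      then have "X s - X t = (s - t) *\<^sub>R ?c"
        using X that unfolding pw_linear_interpolant_def d_def[symmetric]
        by (simp add: scaleR_left_diff_distrib[symmetric] diff_divide_distrib[symmetric])
      then show "dist (X s) (X t) \<le> norm ?c * dist s t" by (simp add: dist_norm mult.commute)
    qed simp
    then show ?thesis by blast
  qed
  have "\<exists>L. L-lipschitz_on {0 .. real j * d} X" if "j \<le> N" for j
    using that
  proof (induction j)
    case 0
    then show ?case by (auto intro!: exI[of _ 0] lipschitz_onI)
  next
    case (Suc j)
    then obtain L M where "L-lipschitz_on {0 .. real j * d} X" "M-lipschitz_on {real j * d .. real (Suc j) * d} X"
      using piece[of j] by auto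
    then show ?case using lipschitz_on_concat_max[of L 0 "real j * d" X M "real (Suc j) * d" X] by auto
  qed
  from this[of N] show ?thesis using N by (simp add: d_def)
qed

lemma pw_linear_derivative:
  fixes X :: "real \<Rightarrow> 'a::real_normed_vector"
  assumes T: "T > 0" and N: "N > 0" and X: "pw_linear_interpolant T N Xk X" and "k < N"
    and t: "t \<in> {real k * (T / real N) <..< real (Suc k) * (T / real N)}"
  shows "(X has_vector_derivative (real N / T) *\<^sub>R (Xk (Suc k) - Xk k)) (at t within {0..T})"
proof -
  define d where "d = T / real N"
  note t = t[folded d_def]
  have "((\<lambda>s. Xk k + ((s - real k * d) / d) *\<^sub>R (Xk (Suc k) - Xk k)) has_vector_derivative
      (1 / d) *\<^sub>R (Xk (Suc k) - Xk k)) (at t)"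
    by (auto intro!: derivative_eq_intros simp: divide_inverse)
  then have "(X has_vector_derivative (1 / d) *\<^sub>R (Xk (Suc k) - Xk k)) (at t)"
    by (rule has_vector_derivative_transform_within_open[OF _ open_greaterThanLessThan t])
      (use X \<open>k < N\<close> in \<open>auto simp: pw_linear_interpolant_def d_def\<close>)
  then show ?thesis by (auto simp: d_def intro: has_vector_derivative_at_within)
qed

lemma pw_linear_time_deriv:
  fixes X :: "real \<Rightarrow> 'a::real_normed_vector"
  assumes T: "T > 0" and N: "N > 0" and X: "pw_linear_interpolant T N Xk X"
    and t: "t \<in> {0..T}" "t \<notin> (\<lambda>k. real k * (T / real N)) ` {..N}"
  shows "(X has_vector_derivative time_deriv T X t) (at t within {0..T})"
proof -
  have "t \<le> real N * (T / real N)" using t N by simp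
  then obtain k where k: "k < N" "t \<in> {real k * (T / real N) .. real (Suc k) * (T / real N)}"
    using grid_cell[of t N "T / real N"] t N by auto
  moreover have "t \<noteq> real j * (T / real N)" if "j \<le> N" for j using t(2) that by blast
  from this[of k] this[of "Suc k"] have "t \<noteq> real k * (T / real N)" "t \<noteq> real (Suc k) * (T / real N)"
    using k(1) by auto
  ultimately have "t \<in> {real k * (T / real N) <..< real (Suc k) * (T / real N)}" by auto
  from pw_linear_derivative[OF T N X k(1) this] show ?thesis
    unfolding time_deriv_def using vector_derivative_works differentiableI_vector by blast
qed

lemma pw_linear_time_deriv_integrable:
  fixes X :: "real \<Rightarrow> 'a::euclidean_space"
  assumes T: "T > 0" and N: "N > 0" and X: "pw_linear_interpolant T N Xk X"
  shows "time_deriv T X absolutely_integrable_on {0..T}"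
proof -
  define d where "d = T / real N"
  have Td: "real N * d = T" using N by (simp add: d_def)
  have "d > 0" using T N by (simp add: d_def)
  have "time_deriv T X absolutely_integrable_on {real k * d .. real (Suc k) * d}" if "k < N" for k
  proof (rule absolutely_integrable_spike)
    show "(\<lambda>t. (real N / T) *\<^sub>R (Xk (Suc k) - Xk k)) absolutely_integrable_on {real k * d .. real (Suc k) * d}"
      by (rule absolutely_integrable_continuous_real) simp
    show "negligible {real k * d, real (Suc k) * d}" by simp
    fix t assume "t \<in> {real k * d .. real (Suc k) * d} - {real k * d, real (Suc k) * d}"
    then have t: "t \<in> {real k * (T / real N) <..< real (Suc k) * (T / real N)}" by (auto simp: d_def)
    have "real (Suc k) * d \<le> T" using that \<open>d > 0\<close> unfolding Td[symmetric] by (intro mult_right_mono) auto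
    moreover have "0 \<le> real k * d" using \<open>d > 0\<close> by simp
    ultimately have "t \<in> cbox 0 T" using t by (auto simp: d_def)
    then show "time_deriv T X t = (real N / T) *\<^sub>R (Xk (Suc k) - Xk k)"
      unfolding time_deriv_def using pw_linear_derivative[OF T N X that t] T
      by (metis box_real(2) vector_derivative_within_cbox)
  qed
  then have "time_deriv T X absolutely_integrable_on (\<Union>k<N. {real k * d .. real (Suc k) * d})"
    by (intro set_integrable_UN) auto
  moreover have "(\<Union>k<N. {real k * d .. real (Suc k) * d}) = {0..T}"
  proof
    show "(\<Union>k<N. {real k * d .. real (Suc k) * d}) \<subseteq> {0..T}"
    proof
      fix t assume "t \<in> (\<Union>k<N. {real k * d .. real (Suc k) * d})"
      then obtain k where k: "k < N" "t \<in> {real k * d .. real (Suc k) * d}" by blast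
      have "real (Suc k) * d \<le> real N * d" "0 \<le> real k * d"
        using k(1) \<open>d > 0\<close> by (auto intro!: mult_right_mono simp del: of_nat_Suc)
      then show "t \<in> {0..T}" using k(2) Td by auto
    qed
    show "{0..T} \<subseteq> (\<Union>k<N. {real k * d .. real (Suc k) * d})"
    proof
      fix t assume "t \<in> {0..T}"
      then have "0 \<le> t" "t \<le> real N * d" using Td by auto
      from grid_cell[OF this N] show "t \<in> (\<Union>k<N. {real k * d .. real (Suc k) * d})" by blast
    qed
  qed
  ultimately show ?thesis by simp
qed

section \<open>Integrability of the data\<close>

lemma inner_absolutely_integrable:
  fixes X w :: "real \<Rightarrow> 'a::euclidean_space"
  assumes "continuous_on {a..b} X" "w absolutely_integrable_on {a..b}"
  shows "(\<lambda>t. X t \<bullet> w t) absolutely_integrable_on {a..b}"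
proof (rule absolutely_integrable_bounded_measurable_product[where h = "(\<bullet>)", OF _ _ _ _ assms(2)])
  show "bilinear ((\<bullet>) :: 'a \<Rightarrow> 'a \<Rightarrow> real)"
    unfolding bilinear_conv_bounded_bilinear by (rule bounded_bilinear_inner)
  show "X \<in> borel_measurable (lebesgue_on {a..b})"
    by (rule continuous_imp_measurable_on_sets_lebesgue[OF assms(1)]) simp
  show "bounded (X ` {a..b})" using assms(1) by (auto intro!: compact_imp_bounded compact_continuous_image)
qed simp

text \<open>The interval has finite length and \<open>2 |w| \<le> 1 + |w|\<^sup>2\<close>.\<close>
lemma L2_on_absolutely_integrable:
  fixes w :: "real \<Rightarrow> 'a::euclidean_space"
  assumes "L2_on T w"
  shows "w absolutely_integrable_on {0..T}"
proof (rule set_integrable_bound)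
  have "(\<lambda>t. 1 :: real) absolutely_integrable_on {0..T}" by (rule absolutely_integrable_continuous_real) simp
  moreover have "(\<lambda>t. (norm (w t))\<^sup>2) absolutely_integrable_on {0..T}" using assms by (simp add: L2_on_def)
  ultimately show "(\<lambda>t. 1 + (norm (w t))\<^sup>2) absolutely_integrable_on {0..T}"
    by (rule set_integral_add(1))
  show "set_borel_measurable lebesgue {0..T} w" using assms by (simp add: L2_on_def)
  have "norm (w t) \<le> norm (1 + (norm (w t))\<^sup>2)" for t
  proof -
    have "2 * norm (w t) \<le> 1 + (norm (w t))\<^sup>2"
      using zero_le_power2[of "norm (w t) - 1"] by (simp add: power2_diff)
    then show ?thesis using norm_ge_zero[of "w t"] unfolding real_norm_def by linarith
  qed
  then show "AE t in lebesgue. t \<in> {0..T} \<longrightarrow> norm (w t) \<le> norm (1 + (norm (w t))\<^sup>2)" by simp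
qed

section \<open>The error representation\<close>

theorem theorem4p1:
  fixes f :: "real^'n::finite \<Rightarrow> real^'m::finite \<Rightarrow> real \<Rightarrow> real^'n"
    and g h :: "real^'n \<Rightarrow> real^'m \<Rightarrow> real \<Rightarrow> real^'m"
    and D :: "((real^'n) \<times> (real^'m) \<times> real) set"
    and y Y ey \<psi>y \<nu>y :: "real \<Rightarrow> real^'n"
    and z Z ez \<psi>z \<nu>z :: "real \<Rightarrow> real^'m"
    and Yk :: "nat \<Rightarrow> real^'n" and Zk :: "nat \<Rightarrow> real^'m"
    and T :: real and N :: nat
  assumes "T > 0" and "N > 0"
    and "openin (top_of_set (UNIV \<times> UNIV \<times> {0..T})) D"
    and "semi_explicit_index1 D g \<or> hessenberg_index2 D f g"
    and "h = index_reduced_rhs T D f g"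
    and "smooth_data T D f g"
    and "dae_solution T f g y z"
    and "bdf1_values T N f g (y 0) (z 0) Yk Zk"
    and "pw_linear_interpolant T N Yk Y" and "pw_linear_interpolant T N Zk Z"
    and "\<forall>t\<in>{0..T}. \<forall>s\<in>{0..1}. (seg_pt s (y t) (Y t), seg_pt s (z t) (Z t), t) \<in> D"
    and "L2_on T \<psi>y" and "L2_on T \<psi>z"
    and "adjoint_solution T f h y z Y Z \<psi>y \<psi>z \<nu>y \<nu>z"
    and "ey = (\<lambda>t. y t - Y t)" and "ez = (\<lambda>t. z t - Z t)"
  shows "QoI T \<psi>y \<psi>z y z - QoI T \<psi>y \<psi>z Y Z = L2_inner T ey \<psi>y + L2_inner T ez \<psi>z
     \<and> QoI T \<psi>y \<psi>z y z - QoI T \<psi>y \<psi>z Y Z =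
         \<nu>y 0 \<bullet> ey 0 + \<nu>z 0 \<bullet> ez 0
         + L2_inner T \<nu>y (\<lambda>t. f (Y t) (Z t) t - time_deriv T Y t)
         + L2_inner T \<nu>z (\<lambda>t. h (Y t) (Z t) t - time_deriv T Z t)"
proof -
  have T: "T > 0" and N: "N > 0" and D: "openin (top_of_set (UNIV \<times> UNIV \<times> {0..T})) D"
    and smooth: "smooth_data T D f g" by fact+
  have ey: "ey t = y t - Y t" and ez: "ez t = z t - Z t" for t
    using assms(15,16) by simp_all
  have seg: "\<forall>s\<in>{0..1}. (seg_pt s (y t) (Y t), seg_pt s (z t) (Z t), t) \<in> D" if "t \<in> {0..T}" for t
    using assms(11) that by blast
  have inD: "(y t, z t, t) \<in> D" and inD': "(Y t, Z t, t) \<in> D" if "t \<in> {0..T}" for t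
    using seg[OF that, rule_format, of 1] seg[OF that, rule_format, of 0] by (simp_all add: seg_pt_def)

  have y': "(y has_vector_derivative f (y t) (z t) t) (at t within {0..T})" if "t \<in> {0..T}" for t
    using assms(7) that by (simp add: dae_solution_def)
  have z': "(z has_vector_derivative h (y t) (z t) t) (at t within {0..T})" if "t \<in> {0..T}" for t
    unfolding assms(5) using index_reduced_ode[OF T D assms(4) smooth assms(7) inD that] by simp
  have C1: "C1_y_on D f" "C1_z_on D f" "C1_y_on D h" "C1_z_on D h"
    and cont: "continuous_on D (\<lambda>(u, v, t). f u v t)" "continuous_on D (\<lambda>(u, v, t). h u v t)"
    using smooth by (auto simp: smooth_data_def assms(5))

  have lip: "\<exists>L. L-lipschitz_on {0..T} Y" "\<exists>L. L-lipschitz_on {0..T} Z"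
    using pw_linear_lipschitz[OF T N assms(9)] pw_linear_lipschitz[OF T N assms(10)] by auto
  have ycont: "continuous_on {0..T} y" "continuous_on {0..T} z"
    using y' z' by (blast intro: continuous_on_vector_derivative)+
  have Ycont: "continuous_on {0..T} Y" "continuous_on {0..T} Z"
    using lip by (auto dest: lipschitz_on_continuous_on)
  have along: "continuous_on {0..T} (\<lambda>t. F (u t) (v t) t)"
    if "continuous_on D (\<lambda>(u, v, t). F u v t)" "continuous_on {0..T} u" "continuous_on {0..T} v"
      "\<And>t. t \<in> {0..T} \<Longrightarrow> (u t, v t, t) \<in> D" for F :: "('n, 'm, 'c::topological_space) fld" and u v
  proof -
    have "continuous_on {0..T} (\<lambda>t. (\<lambda>(u, v, t). F u v t) (u t, v t, t))"
      by (rule continuous_on_compose2[OF that(1)]) (use that(2-4) in \<open>auto intro!: continuous_intros\<close>)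
    then show ?thesis by simp
  qed
  have lip': "\<exists>L. L-lipschitz_on {0..T} y" "\<exists>L. L-lipschitz_on {0..T} z"
    using lipschitz_on_of_continuous_derivative[OF y' along[OF cont(1) ycont inD]]
      lipschitz_on_of_continuous_derivative[OF z' along[OF cont(2) ycont inD]] by auto
  have "\<exists>L. L-lipschitz_on {0..T} ey" "\<exists>L. L-lipschitz_on {0..T} ez"
    unfolding assms(15,16) using lip lip' by (blast intro: lipschitz_on_diff)+
  then have e_ac: "abs_continuous_on 0 T ey" "abs_continuous_on 0 T ez"
    by (auto intro: lipschitz_imp_abs_continuous)
  have nu_ac: "abs_continuous_on 0 T \<nu>y" "abs_continuous_on 0 T \<nu>z" and nuT: "\<nu>y T = 0" "\<nu>z T = 0"
    using assms(14) by (auto simp: adjoint_solution_def)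

  let ?Ry = "\<lambda>t. f (Y t) (Z t) t - time_deriv T Y t" and ?Rz = "\<lambda>t. h (Y t) (Z t) t - time_deriv T Z t"
  let ?fy = "mean_jac (D_y f) y z Y Z" and ?fz = "mean_jac (D_z f) y z Y Z"
  let ?hy = "mean_jac (D_y h) y z Y Z" and ?hz = "mean_jac (D_z h) y z Y Z"
  \<comment> \<open>The right-hand sides of the adjoint equations, and of the error equations
    \<open>e' = J e + residual\<close> with the mean Jacobian \<open>J\<close>.\<close>
  define \<nu>y' where "\<nu>y' t = - (transpose (?fy t) *v \<nu>y t + transpose (?hy t) *v \<nu>z t + \<psi>y t)" for t
  define \<nu>z' where "\<nu>z' t = - (transpose (?fz t) *v \<nu>y t + transpose (?hz t) *v \<nu>z t + \<psi>z t)" for t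
  define ey' where "ey' t = ?fy t *v ey t + ?fz t *v ez t + ?Ry t" for t
  define ez' where "ez' t = ?hy t *v ey t + ?hz t *v ez t + ?Rz t" for t
  have "AE t in lebesgue. t \<in> {0..T} \<longrightarrow> (\<nu>y has_vector_derivative \<nu>y' t) (at t within {0..T})
      \<and> (\<nu>z has_vector_derivative \<nu>z' t) (at t within {0..T})"
    using assms(14) by (simp add: adjoint_solution_def \<nu>y'_def \<nu>z'_def)
  then obtain E where E: "E \<in> null_sets lebesgue" and nu':
    "\<And>t. t \<in> {0..T} - E \<Longrightarrow> (\<nu>y has_vector_derivative \<nu>y' t) (at t within {0..T})"
    "\<And>t. t \<in> {0..T} - E \<Longrightarrow> (\<nu>z has_vector_derivative \<nu>z' t) (at t within {0..T})"
    by (elim AE_E3) auto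
  \<comment> \<open>At the nodes \<open>Y\<close> and \<open>Z\<close> need not be
    differentiable.\<close>
  define E' where "E' = E \<union> (\<lambda>k. real k * (T / real N)) ` {..N}"
  have negl: "negligible E'"
    using E by (simp add: E'_def negligible_iff_null_sets[symmetric] negligible_Un negligible_finite)
  have e': "(ey has_vector_derivative ey' t) (at t within {0..T})" "(ez has_vector_derivative ez' t) (at t within {0..T})"
    if "t \<in> {0..T} - E'" for t
  proof -
    have t: "t \<in> {0..T}" and node: "t \<notin> (\<lambda>k. real k * (T / real N)) ` {..N}"
      using that by (auto simp: E'_def)
    have "ey' t = f (y t) (z t) t - time_deriv T Y t" "ez' t = h (y t) (z t) t - time_deriv T Z t"
      using mean_value_mean_jac[where y = y and Y = Y and z = z and Z = Z, OF D C1(1,2) seg[OF t]]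
        mean_value_mean_jac[where y = y and Y = Y and z = z and Z = Z, OF D C1(3,4) seg[OF t]]
      by (simp_all add: ey'_def ez'_def ey ez algebra_simps)
    then show "(ey has_vector_derivative ey' t) (at t within {0..T})" "(ez has_vector_derivative ez' t) (at t within {0..T})"
      unfolding assms(15,16)
      using has_vector_derivative_diff[OF y'[OF t] pw_linear_time_deriv[OF T N assms(9) t node]]
        has_vector_derivative_diff[OF z'[OF t] pw_linear_time_deriv[OF T N assms(10) t node]] by simp_all
  qed
  have "((\<lambda>t. \<nu>y t \<bullet> ey' t + \<nu>y' t \<bullet> ey t) has_integral \<nu>y T \<bullet> ey T - \<nu>y 0 \<bullet> ey 0) {0..T}"
    using T by (intro fundamental_theorem_of_calculus_abs_continuous[OF _ abs_continuous_inner[OF nu_ac(1) e_ac(1)] negl]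
        bounded_bilinear.has_vector_derivative[OF bounded_bilinear_inner] nu' e') (auto simp: E'_def)
  moreover have "((\<lambda>t. \<nu>z t \<bullet> ez' t + \<nu>z' t \<bullet> ez t) has_integral \<nu>z T \<bullet> ez T - \<nu>z 0 \<bullet> ez 0) {0..T}"
    using T by (intro fundamental_theorem_of_calculus_abs_continuous[OF _ abs_continuous_inner[OF nu_ac(2) e_ac(2)] negl]
        bounded_bilinear.has_vector_derivative[OF bounded_bilinear_inner] nu' e') (auto simp: E'_def)
  ultimately have "((\<lambda>t. (\<nu>y t \<bullet> ey' t + \<nu>y' t \<bullet> ey t) + (\<nu>z t \<bullet> ez' t + \<nu>z' t \<bullet> ez t)) has_integral
     (\<nu>y T \<bullet> ey T - \<nu>y 0 \<bullet> ey 0) + (\<nu>z T \<bullet> ez T - \<nu>z 0 \<bullet> ez 0)) {0..T}"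
    by (rule has_integral_add)
  \<comment> \<open>The Jacobians cancel because the adjoint equations use their transposes.\<close>
  moreover have "(\<nu>y t \<bullet> ey' t + \<nu>y' t \<bullet> ey t) + (\<nu>z t \<bullet> ez' t + \<nu>z' t \<bullet> ez t)
      = (\<nu>y t \<bullet> ?Ry t + \<nu>z t \<bullet> ?Rz t) - (ey t \<bullet> \<psi>y t + ez t \<bullet> \<psi>z t)" for t
  proof -
    have adj: "(transpose A *v p) \<bullet> q = p \<bullet> (A *v q)" for A :: "real^'a^'b" and p q
      by (simp add: transpose_matrix_vector dot_lmul_matrix)
    show ?thesis
      by (simp add: ey'_def ez'_def \<nu>y'_def \<nu>z'_def inner_add_left inner_add_right inner_diff_left adj
          inner_commute[of "\<psi>y t"] inner_commute[of "\<psi>z t"] del: transpose_matrix_vector)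
  qed
  ultimately have total: "((\<lambda>t. (\<nu>y t \<bullet> ?Ry t + \<nu>z t \<bullet> ?Rz t) - (ey t \<bullet> \<psi>y t + ez t \<bullet> \<psi>z t))
      has_integral - (\<nu>y 0 \<bullet> ey 0) - \<nu>z 0 \<bullet> ez 0) {0..T}"
    by (simp add: nuT)

  have psi: "\<psi>y absolutely_integrable_on {0..T}" "\<psi>z absolutely_integrable_on {0..T}"
    using assms(12,13) by (auto intro: L2_on_absolutely_integrable)
  have res: "?Ry absolutely_integrable_on {0..T}" "?Rz absolutely_integrable_on {0..T}"
    by (intro set_integral_diff(1) absolutely_integrable_continuous_real along[OF cont(1) Ycont inD']
        along[OF cont(2) Ycont inD'] pw_linear_time_deriv_integrable[OF T N assms(9)]
        pw_linear_time_deriv_integrable[OF T N assms(10)]; assumption)+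
  have L2: "((\<lambda>t. X t \<bullet> w t) has_integral L2_inner T X w) {0..T}"
    if "continuous_on {0..T} X" "w absolutely_integrable_on {0..T}" for X w :: "real \<Rightarrow> 'c::euclidean_space"
    unfolding L2_inner_def by (rule has_integral_set_lebesgue[OF inner_absolutely_integrable[OF that]])
  have econt: "continuous_on {0..T} ey" "continuous_on {0..T} ez"
    and nucont: "continuous_on {0..T} \<nu>y" "continuous_on {0..T} \<nu>z"
    using e_ac nu_ac by (auto intro: abs_continuous_imp_continuous)
  have "((\<lambda>t. (\<nu>y t \<bullet> ?Ry t + \<nu>z t \<bullet> ?Rz t) - (ey t \<bullet> \<psi>y t + ez t \<bullet> \<psi>z t)) has_integral
     (L2_inner T \<nu>y ?Ry + L2_inner T \<nu>z ?Rz) - (L2_inner T ey \<psi>y + L2_inner T ez \<psi>z)) {0..T}"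
    by (intro has_integral_diff has_integral_add L2 econt nucont psi res)
  from has_integral_unique[OF total this]
  have rep: "L2_inner T ey \<psi>y + L2_inner T ez \<psi>z = \<nu>y 0 \<bullet> ey 0 + \<nu>z 0 \<bullet> ez 0
      + L2_inner T \<nu>y ?Ry + L2_inner T \<nu>z ?Rz" by simp
  have split: "L2_inner T (\<lambda>t. x t - X t) w = L2_inner T x w - L2_inner T X w"
    if "continuous_on {0..T} x" "continuous_on {0..T} X" "w absolutely_integrable_on {0..T}"
    for x X w :: "real \<Rightarrow> 'c::euclidean_space"
  proof (rule has_integral_unique)
    show "((\<lambda>t. (x t - X t) \<bullet> w t) has_integral L2_inner T (\<lambda>t. x t - X t) w) {0..T}"
      by (intro L2 that continuous_intros)
    show "((\<lambda>t. (x t - X t) \<bullet> w t) has_integral L2_inner T x w - L2_inner T X w) {0..T}"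
      unfolding inner_diff_left by (intro has_integral_diff L2 that)
  qed
  have "QoI T \<psi>y \<psi>z y z - QoI T \<psi>y \<psi>z Y Z = L2_inner T ey \<psi>y + L2_inner T ez \<psi>z"
    using split[OF ycont(1) Ycont(1) psi(1)] split[OF ycont(2) Ycont(2) psi(2)]
    by (simp add: QoI_def assms(15,16))
  then show ?thesis using rep by simp
qed

end
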